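(* Let $d\ge 1$ and let $\mu\in\mathcal{P}([0,1]^d)$ be a quasi-Bernoulli probability measure fully supported on $[0,1]^d$ (i.e. its topological support is $[0,1]^d$). Let $(B_n=B(x_n,r_n))_{n\in\mathbb{N}}$ be a sequence of closed balls (for the norm $\|\cdot\|_\infty$) in $[0,1]^d$ such that $\lim_{n\to+\infty} r_n=0$ and $\mu\big(\limsup_{n\to+\infty}B_n\big)=1$. Let $1\le \tau_1\le \tau_2\le\dots\le\tau_d$ be real numbers, $\boldsymbol{\tau}=(\tau_1,\dots,\tau_d)$, and let $(O_n)_{n\in\mathbb{N}}\in\mathcal{O}_d(\mathbb{R})^{\mathbb{N}}$ be a sequence of orthogonal $d\times d$ matrices. For $n\in\mathbb{N}$ set $$R_n=x_n+O_n\widetilde{R}_n,\qquad \widetilde{R}_n=\mathrm{diag}(r_n^{\tau_1},\dots,r_n^{\tau_d})\cdot[0,1]^d,$$ and set $$s(\mu,\boldsymbol{\tau})=\min_{1\le k\le d}\left(\frac{\underline{\dim}_H(\mu)+\sum_{1\le j\le k}(\tau_k-\tau_j)}{\tau_k}\right).$$ Then $$\dim_H\Big(\limsup_{n\to+\infty}R_n\Big)\ge s(\mu,\boldsymbol{\tau}).$$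
   Context: $\mathbb{R}^d$ is endowed with the norm $\|\cdot\|_\infty$, and $B(x,r)$ denotes the closed ball of center $x$ and radius $r$. $\mathcal{P}([0,1]^d)$ is the set of Borel probability measures on $[0,1]^d$. $\dim_H$ of a set is its Hausdorff dimension. For sets $A_n$, $\limsup_{n\to+\infty}A_n$ is the set of points belonging to $A_n$ for infinitely many $n$. $\mathrm{diag}(a_1,\dots,a_d)$ is the diagonal matrix with diagonal entries $a_1,\dots,a_d$, so $\widetilde R_n=\prod_{i=1}^d[0,r_n^{\tau_i}]$. Lower Hausdorff dimension of a measure: for $\mu\in\mathcal{P}([0,1]^d)$ and $x$ in the support of $\mu$, the lower local dimension is $\underline{\dim}_{\rm loc}(\mu,x)=\liminf_{r\to0^+}\frac{\log\mu(B(x,r))}{\log r}$, and $\underline{\dim}_H(\mu)$ is the $\mu$-essential infimum of $x\mapsto\underline{\dim}_{\rm loc}(\mu,x)$. Dyadic cubes: for $p\in\mathbb{N}$, $\mathcal{D}_p$ is the set of closed dyadic subcubes of $[0,1]^d$ of generation $p$, i.e. the cubes $\prod_{i=1}^d[k_i2^{-p},(k_i+1)2^{-p}]$ with integers $0\le k_i\le 2^p-1$. Quasi-Bernoulli measure: let $\mu\in\mathcal{P}([0,1]^d)$. For a closed dyadic subcube $D$ of $[0,1]^d$ with $\mu(D)>0$, let $\mu_D=\mu|_D/\mu(D)$ be the normalized restriction of $\mu$ to $D$, let $T_D:D\to[0,1]^d$ be the canonical affine map (homothety composed with translation) sending $D$ onto $[0,1]^d$, and let $\mu^D=T_D\mu_D=\mu_D\circ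 T_D^{-1}\in\mathcal{P}([0,1]^d)$. The measure $\mu$ is quasi-Bernoulli if there exists a constant $C_\mu\ge1$ such that for every $p\in\mathbb{N}$ and every $D\in\mathcal{D}_p$ with $\mu(D)>0$, one has $\frac{1}{C_\mu}\mu\le\mu^D\le C_\mu\,\mu$ (inequalities between measures, i.e. on every Borel subset of $[0,1]^d$). *)

theory Defs
  imports "HOL-Probability.Probability"
begin

section \<open>Balls and Hausdorff dimension for the supremum norm\<close>

text \<open>The library's \<^const>\<open>cball\<close> and \<^const>\<open>diameter\<close> refer to the Euclidean norm; here
  everything is metric with respect to the supremum norm \<^const>\<open>infnorm\<close>.\<close>

definition inf_cball :: "'a::euclidean_space \<Rightarrow> real \<Rightarrow> 'a set" where
  "inf_cball x r = {y. infnorm (y - x) \<le> r}"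

definition inf_diameter :: "'a::euclidean_space set \<Rightarrow> real" where
  "inf_diameter S = (if S = {} then 0 else SUP (x, y)\<in>S \<times> S. infnorm (x - y))"

definition hausdorff_premeasure :: "real \<Rightarrow> real \<Rightarrow> 'a::euclidean_space set \<Rightarrow> ennreal" where
  "hausdorff_premeasure \<delta> s E =
     (INF U\<in>{U :: nat \<Rightarrow> 'a set. E \<subseteq> (\<Union>n. U n) \<and> (\<forall>n. bounded (U n) \<and> inf_diameter (U n) \<le> \<delta>)}.
        \<Sum>n. ennreal (inf_diameter (U n) powr s))"

definition hausdorff_measure :: "real \<Rightarrow> 'a::euclidean_space set \<Rightarrow> ennreal" where
  "hausdorff_measure s E = (SUP \<delta>\<in>{0<..}. hausdorff_premeasure \<delta> s E)"

text \<open>Only exponents \<open>s > 0\<close> are used, because \<open>0 powr 0 = 0\<close> makes the case \<open>s = 0\<close> above differ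
  from counting measure. This does not change the infimum.\<close>

definition hausdorff_dim :: "'a::euclidean_space set \<Rightarrow> ereal" where
  "hausdorff_dim E = Inf {ereal s | s. 0 < s \<and> hausdorff_measure s E = 0}"

section \<open>Probability measures on the unit cube\<close>

text \<open>A Borel probability measure on the cube is encoded as a Borel probability measure on the whole
  space that gives mass 1 to the cube.\<close>

definition cube_prob :: "(real^'n) measure \<Rightarrow> bool" where
  "cube_prob \<mu> \<longleftrightarrow> prob_space \<mu> \<and> sets \<mu> = sets borel \<and> emeasure \<mu> (cbox 0 1) = 1"

definition topological_support :: "'a::topological_space measure \<Rightarrow> 'a set" where
  "topological_support \<mu> = {x. \<forall>U. open U \<and> x \<in> U \<longrightarrow> emeasure \<mu> U > 0}"

definition lower_local_dim :: "'a::euclidean_space measure \<Rightarrow> 'a \<Rightarrow> ereal" where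
  "lower_local_dim \<mu> x =
     Liminf (at_right 0) (\<lambda>r. ereal (ln (measure \<mu> (inf_cball x r)) / ln r))"

definition essential_inf :: "'a measure \<Rightarrow> ('a \<Rightarrow> ereal) \<Rightarrow> ereal" where
  "essential_inf \<mu> f = Sup {c. AE x in \<mu>. c \<le> f x}"

text \<open>The values of \<^const>\<open>lower_local_dim\<close> off the support are irrelevant here, since the
  complement of the support is a null set.\<close>

definition lower_hausdorff_dim :: "'a::euclidean_space measure \<Rightarrow> ereal" where
  "lower_hausdorff_dim \<mu> = essential_inf \<mu> (lower_local_dim \<mu>)"

section \<open>Quasi-Bernoulli measures\<close>

text \<open>A dyadic cube of generation \<open>p\<close> is given by an index vector \<open>k\<close>; it lies in the unit cube
  iff \<open>k i < 2 ^ p\<close> for all \<open>i\<close>.\<close>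

definition dyadic_corner :: "nat \<Rightarrow> ('n \<Rightarrow> nat) \<Rightarrow> real^'n" where
  "dyadic_corner p k = (\<chi> i. real (k i) / 2 ^ p)"

definition dyadic_cube :: "nat \<Rightarrow> ('n::finite \<Rightarrow> nat) \<Rightarrow> (real^'n) set" where
  "dyadic_cube p k = cbox (dyadic_corner p k) (dyadic_corner p (\<lambda>i. k i + 1))"

definition dyadic_chart :: "nat \<Rightarrow> ('n::finite \<Rightarrow> nat) \<Rightarrow> real^'n \<Rightarrow> real^'n" where
  "dyadic_chart p k x = 2 ^ p *\<^sub>R (x - dyadic_corner p k)"

text \<open>The measure \<open>\<mu>\<^sup>D\<close>: \<^const>\<open>uniform_measure\<close> is the normalized restriction of \<open>\<mu>\<close> to \<open>D\<close>.\<close>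

definition rescaled_measure :: "(real^'n) measure \<Rightarrow> nat \<Rightarrow> ('n::finite \<Rightarrow> nat) \<Rightarrow> (real^'n) measure" where
  "rescaled_measure \<mu> p k = distr (uniform_measure \<mu> (dyadic_cube p k)) borel (dyadic_chart p k)"

definition quasi_bernoulli :: "(real^'n) measure \<Rightarrow> bool" where
  "quasi_bernoulli \<mu> \<longleftrightarrow>
     (\<exists>C\<ge>1. \<forall>p k. (\<forall>i. k i < 2 ^ p) \<and> emeasure \<mu> (dyadic_cube p k) > 0 \<longrightarrow>
        (\<forall>A\<in>sets borel. A \<subseteq> cbox 0 1 \<longrightarrow>
           ennreal (1 / C) * emeasure \<mu> A \<le> emeasure (rescaled_measure \<mu> p k) A \<and>
           emeasure (rescaled_measure \<mu> p k) A \<le> ennreal C * emeasure \<mu> A))"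

section \<open>Rectangles and the dimension bound\<close>

definition diag_matrix :: "('n \<Rightarrow> real) \<Rightarrow> real^'n^'n" where
  "diag_matrix a = (\<chi> i j. if i = j then a i else 0)"

definition std_rectangle :: "('n::finite \<Rightarrow> real) \<Rightarrow> real \<Rightarrow> (real^'n) set" where
  "std_rectangle \<tau> r = (\<lambda>y. diag_matrix (\<lambda>i. r powr \<tau> i) *v y) ` cbox 0 1"

definition rectangle :: "('n::finite \<Rightarrow> real) \<Rightarrow> real^'n \<Rightarrow> real \<Rightarrow> real^'n^'n \<Rightarrow> (real^'n) set" where
  "rectangle \<tau> x r Q = (\<lambda>y. x + Q *v y) ` std_rectangle \<tau> r"

text \<open>The coordinates \<open>1, \<dots>, d\<close> are the elements of a finite well-ordered index type, in increasing
  order.\<close>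

definition dim_bound :: "(real^'n::{finite,wellorder}) measure \<Rightarrow> ('n \<Rightarrow> real) \<Rightarrow> ereal" where
  "dim_bound \<mu> \<tau> =
     (MIN k. (lower_hausdorff_dim \<mu> + ereal (\<Sum>j\<in>{..k}. \<tau> k - \<tau> j)) / ereal (\<tau> k))"

end

(*
  By quasi-Bernoullicity, every dyadic cube D carries, inside a compact subset of its interior, a
  copy of a set of positive measure on which the normalized restriction of mu to D satisfies a
  Frostman condition of exponent a close to dim_H(mu), with constants independent of D. The balls
  B_n cover this set up to a null set; a Vitali selection of finitely many of them, whose mass is
  then spread uniformly over the rectangles R_n, shows that the s-content of D intersected with the
  union of the R_n, n >= N, is at least c |D|^s for every s < s(mu, tau), with c independent of D
  and N.

  A lower bound of this kind in all cubes passes to countable intersections (Falconer's classes of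
  sets with large intersections): for s < d it improves itself to c = 1, so one can refine finite
  families of dyadic cubes infinitely often without losing any content.
*)
theory Submission
  imports Defs
begin

section \<open>Contents on the tree of dyadic cubes\<close>

text \<open>The value s(\<mu>,\<tau>) enters through one estimate: if a mass of order r^a is spread
  evenly over the rectangle of a ball of radius r, a cube of side \<rho> receives at most about r^a
  \<Prod>_j min(1, \<rho>/r^(\<tau>_j)). With \<rho> = r^t, the bound \<rho>^s for this follows from
  the inequalities s \<tau>_k \<le> a + \<Sum>_(j \<le> k) (\<tau>_k - \<tau>_j). The obstacle is
  uniformity: in a cube of side \<delta> the Frostman bound carries a factor \<delta>^(-a), while c
  must not depend on \<delta>. Hence two exponents a' < a are kept. The inequalities hold with a',
  and the spare factor r^(a - a') beats any power of \<delta> once the balls used in that cube are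
  small enough, which starting late in the sequence permits. Contents are bounded below by finite
  sums of masses on the tree of closed dyadic cubes, so no limit measure is built. Faces of cubes
  are not assumed to be null; masses are only required to be subadditive. The inequality s < d comes
  from counting cubes: the Frostman exponent of a set of positive mass is at most d.\<close>

definition parent :: "('n \<Rightarrow> nat) \<Rightarrow> 'n \<Rightarrow> nat" where
  "parent k = (\<lambda>i. k i div 2)"

definition ancestor :: "nat \<Rightarrow> ('n \<Rightarrow> nat) \<Rightarrow> 'n \<Rightarrow> nat" where
  "ancestor m k = (\<lambda>i. k i div 2 ^ m)"

definition children :: "('n \<Rightarrow> nat) \<Rightarrow> ('n \<Rightarrow> nat) set" where
  "children k = {k'. parent k' = k}"

definition indices :: "nat \<Rightarrow> ('n \<Rightarrow> nat) set" where
  "indices p = {k. \<forall>i. k i < 2 ^ p}"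

lemma children_eq: "children (k :: 'n::finite \<Rightarrow> nat) = PiE UNIV (\<lambda>i. {2 * k i, 2 * k i + 1})"
proof -
  have "k' i div 2 = k i \<longleftrightarrow> k' i \<in> {2 * k i, 2 * k i + 1}" for k' i
    by auto
  then show ?thesis
    by (auto simp: children_def parent_def fun_eq_iff PiE_def Pi_def)
qed

lemma finite_children [simp]: "finite (children (k :: 'n::finite \<Rightarrow> nat))"
  unfolding children_eq by (intro finite_PiE) auto

lemma card_children [simp]: "card (children (k :: 'n::finite \<Rightarrow> nat)) = 2 ^ CARD('n)"
  unfolding children_eq by (subst card_PiE) (auto simp: numeral_2_eq_2)

lemma ancestor_0 [simp]: "ancestor 0 k = k"
  by (simp add: ancestor_def)

lemma ancestor_add: "ancestor (m + n) k = ancestor n (ancestor m k)"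
  by (simp add: ancestor_def div_mult2_eq power_add)

lemma parent_eq_ancestor: "parent k = ancestor 1 k"
  by (simp add: parent_def ancestor_def)

lemma ancestor_Suc: "ancestor (Suc m) k = parent (ancestor m k)"
  using ancestor_add[of m 1 k] by (simp add: parent_eq_ancestor)

lemma children_indices: "k \<in> indices p \<Longrightarrow> k' \<in> children k \<Longrightarrow> k' \<in> indices (Suc p)"
  by (auto simp: indices_def children_def parent_def fun_eq_iff)
    (metis less_mult_imp_div_less div_less_iff_less_mult mult.commute pos2)

lemma indices_eq: "indices p = PiE UNIV (\<lambda>i. {..<2 ^ p})"
  by (auto simp: indices_def PiE_def Pi_def)

lemma finite_indices [simp]: "finite (indices p :: ('n::finite \<Rightarrow> nat) set)"
  unfolding indices_eq by (intro finite_PiE) auto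

lemma card_indices: "card (indices p :: ('n::finite \<Rightarrow> nat) set) = (2 ^ p) ^ CARD('n)"
  unfolding indices_eq by (simp add: card_PiE)

text \<open>\<open>cap q A i p k\<close> is the least value of \<open>\<Sum>Q. q ^ generation Q\<close> over the covers, by dyadic
  subcubes of the cube \<open>(p, k)\<close>, of the union of the cubes of generation \<open>p + i\<close> whose
  index is in \<open>A\<close>. With \<open>q = 2 powr (-s)\<close> it is an \<open>s\<close>-dimensional content.\<close>

fun cap :: "real \<Rightarrow> ('n \<Rightarrow> nat) set \<Rightarrow> nat \<Rightarrow> nat \<Rightarrow> ('n \<Rightarrow> nat) \<Rightarrow> real" where
  "cap q A 0 p k = (if k \<in> A then q ^ p else 0)"
| "cap q A (Suc i) p k = min (q ^ p) (\<Sum>k'\<in>children k. cap q A i (Suc p) k')"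

lemma cap_nonneg: "0 \<le> q \<Longrightarrow> 0 \<le> cap q A i p k"
  by (induction i arbitrary: p k) (auto intro: sum_nonneg)

lemma cap_mono:
  assumes "\<And>l. l \<in> A \<Longrightarrow> ancestor i l = k \<Longrightarrow> l \<in> B" and "0 \<le> q"
  shows "cap q A i p k \<le> cap q B i p k"
  using assms(1)
proof (induction i arbitrary: p k)
  case 0
  then show ?case
    using assms(2) by auto
next
  case (Suc i)
  have "cap q A i (Suc p) k' \<le> cap q B i (Suc p) k'" if "k' \<in> children k" for k'
    using Suc.prems that by (intro Suc.IH) (auto simp: ancestor_Suc children_def)
  then show ?case
    unfolding cap.simps by (intro min.mono sum_mono) auto
qed

text \<open>The recursion sees a leaf of generation \<open>p + i\<close> only through its cost
  \<open>q ^ (p + i)\<close>, so hanging a subtree of full content below each leaf cannot lower the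
  value. A subtree holding only a proportion of the content would cost that factor at every
  refinement.\<close>

lemma cap_compose:
  assumes "\<And>l. l \<in> A \<Longrightarrow> q ^ (p + i) \<le> cap q B j (p + i) l" and "0 \<le> q"
  shows "cap q A i p k \<le> cap q B (i + j) p k"
  using assms(1)
proof (induction i arbitrary: p k)
  case 0
  then show ?case
    using assms(2) cap_nonneg by auto
next
  case (Suc i)
  have "cap q A i (Suc p) k' \<le> cap q B (i + j) (Suc p) k'" for k'
    using Suc.prems by (intro Suc.IH) auto
  then show ?case
    unfolding cap.simps add_Suc by (intro min.mono sum_mono) auto
qed

text \<open>At a node that belongs to \<open>C\<close> its own cost is enough; at any other node
  every relevant leaf is covered strictly below, so the bounds of the children add up. They add
  without overlap because distinct children have disjoint sets of descendants.\<close>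

lemma cap_le_sum_cover:
  fixes k :: "'n::finite \<Rightarrow> nat"
  assumes "finite C" "0 \<le> q"
    and "\<And>l. l \<in> A \<Longrightarrow> ancestor i l = k \<Longrightarrow>
      \<exists>g. p \<le> g \<and> g \<le> p + i \<and> (g, ancestor (p + i - g) l) \<in> C"
  shows "cap q A i p k \<le> (\<Sum>(g, c) \<in> {(g, c) \<in> C. p \<le> g \<and> ancestor (g - p) c = k}. q ^ g)"
    (is "_ \<le> sum ?f (?D p k)")
  using assms(3)
proof (induction i arbitrary: p k)
  case 0
  have fin: "finite (?D p k)"
    by (rule finite_subset[OF _ assms(1)]) auto
  have nonneg: "0 \<le> sum ?f (?D p k)"
    using assms(2) by (intro sum_nonneg) auto
  show ?case
  proof (cases "k \<in> A")
    case True
    then have "(p, k) \<in> ?D p k"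
      using 0[OF True] by auto
    then have "?f (p, k) \<le> sum ?f (?D p k)"
      using fin assms(2) by (intro member_le_sum) auto
    then show ?thesis
      using True by simp
  qed (use nonneg in auto)
next
  case (Suc i)
  have fin: "finite (?D p k)" for p k
    by (rule finite_subset[OF _ assms(1)]) auto
  show ?case
  proof (cases "(p, k) \<in> C")
    case True
    then have "?f (p, k) \<le> sum ?f (?D p k)"
      using fin assms(2) by (intro member_le_sum) auto
    then show ?thesis
      by (simp add: min.coboundedI1)
  next
    case False
    have "(\<Sum>k'\<in>children k. cap q A i (Suc p) k') \<le> (\<Sum>k'\<in>children k. sum ?f (?D (Suc p) k'))"
    proof (rule sum_mono)
      fix k' assume k': "k' \<in> children k"
      show "cap q A i (Suc p) k' \<le> sum ?f (?D (Suc p) k')"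
      proof (rule Suc.IH)
        fix l assume l: "l \<in> A" "ancestor i l = k'"
        with k' have anc: "ancestor (Suc i) l = k"
          by (simp add: ancestor_Suc children_def)
        obtain g where g: "p \<le> g" "g \<le> p + Suc i" "(g, ancestor (p + Suc i - g) l) \<in> C"
          using Suc.prems[OF l(1) anc] by auto
        then have "g \<noteq> p"
          using False anc by auto
        with g show "\<exists>g. Suc p \<le> g \<and> g \<le> Suc p + i \<and> (g, ancestor (Suc p + i - g) l) \<in> C"
          by (intro exI[of _ g]) auto
      qed
    qed
    also have "\<dots> = sum ?f (\<Union>k'\<in>children k. ?D (Suc p) k')"
      using fin by (intro sum.UNION_disjoint[symmetric]) auto
    also have "\<dots> \<le> sum ?f (?D p k)"
    proof (rule sum_mono2)
      show "(\<Union>k'\<in>children k. ?D (Suc p) k') \<subseteq> ?D p k"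
      proof safe
        fix k' g c assume "Suc p \<le> g" "ancestor (g - Suc p) c \<in> children k"
        then show "ancestor (g - p) c = k"
          using ancestor_Suc[of "g - Suc p" c] by (simp add: children_def Suc_diff_Suc)
      qed auto
    qed (use fin assms(2) in auto)
    finally show ?thesis
      by simp
  qed
qed

text \<open>The mass distribution principle on the tree, the easy half of max-flow min-cut: the mass
  of a node is bounded by its cost, is passed on to its children, and dies at leaves outside
  \<open>A\<close>. Subadditivity of \<open>\<nu>\<close> is the right requirement because closed
  cubes share faces.\<close>

lemma mass_le_cap:
  fixes k :: "'n::finite \<Rightarrow> nat" and \<nu> :: "nat \<Rightarrow> ('n \<Rightarrow> nat) \<Rightarrow> real"
  assumes "\<And>p l. \<nu> p l \<le> (\<Sum>l'\<in>children l. \<nu> (Suc p) l')"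
    and "\<And>g l. p \<le> g \<Longrightarrow> ancestor (g - p) l = k \<Longrightarrow> \<nu> g l \<le> q ^ g"
    and "\<And>l. ancestor i l = k \<Longrightarrow> l \<notin> A \<Longrightarrow> \<nu> (p + i) l \<le> 0"
  shows "\<nu> p k \<le> cap q A i p k"
  using assms(2,3)
proof (induction i arbitrary: p k)
  case 0
  then show ?case
    using 0(1)[of p k] 0(2)[of k] by auto
next
  case (Suc i)
  have "\<nu> (Suc p) k' \<le> cap q A i (Suc p) k'" if "k' \<in> children k" for k'
  proof (rule Suc.IH)
    fix g l assume "Suc p \<le> g" "ancestor (g - Suc p) l = k'"
    then show "\<nu> g l \<le> q ^ g"
      using that ancestor_Suc[of "g - Suc p" l]
      by (intro Suc.prems(1)) (auto simp: children_def Suc_diff_Suc)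
  next
    fix l assume "ancestor i l = k'" "l \<notin> A"
    then show "\<nu> (Suc p + i) l \<le> 0"
      using that Suc.prems(2)[of l] by (simp add: ancestor_Suc children_def)
  qed
  then have "\<nu> p k \<le> (\<Sum>k'\<in>children k. cap q A i (Suc p) k')"
    using assms(1)[of p k] by (meson order_trans sum_mono)
  moreover have "\<nu> p k \<le> q ^ p"
    using Suc.prems(1)[of p k] by simp
  ultimately show ?case
    by simp
qed

text \<open>The condition on \<open>q\<close> says s \<le> d: the 2^d children together cost at
  least as much as the parent, so looking at a hereditary family one generation deeper never lowers
  the content.\<close>

lemma cap_mono_depth:
  fixes S :: "nat \<Rightarrow> ('n::finite \<Rightarrow> nat) set"
  assumes hered: "\<And>p k k'. k \<in> S p \<Longrightarrow> k' \<in> children k \<Longrightarrow> k' \<in> S (Suc p)"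
    and q: "0 < q" "1 \<le> 2 ^ CARD('n) * q" and "i \<le> j"
  shows "cap q (S (p + i)) i p k \<le> cap q (S (p + j)) j p k"
proof -
  have "cap q (S (p + i)) i p k \<le> cap q (S (p + Suc i)) (Suc i) p k" for i
  proof -
    have "q ^ g \<le> cap q (S (Suc g)) 1 g l" if "l \<in> S g" for g l
    proof -
      have "(\<Sum>k'\<in>children l. cap q (S (Suc g)) 0 (Suc g) k') = (\<Sum>k'\<in>children l. q ^ Suc g)"
        using hered[OF that] by (intro sum.cong) auto
      also have "\<dots> = (2 ^ CARD('n) * q) * q ^ g"
        by simp
      also have "\<dots> \<ge> 1 * q ^ g"
        using q by (intro mult_right_mono) auto
      finally show ?thesis
        by simp
    qed
    then show ?thesis
      using q cap_compose[of "S (p + i)" q p i "S (p + Suc i)" 1 k] by simp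
  qed
  with \<open>i \<le> j\<close> show ?thesis
    by (induction j rule: dec_induct) (use order_trans in blast)+
qed

text \<open>The proportion of the content captured in every cube grows by the factor \<open>2 ^ d * q > 1\<close> when
  passing from the children to the parent, so it reaches 1.\<close>

lemma cap_full:
  fixes S :: "nat \<Rightarrow> ('n::finite \<Rightarrow> nat) set"
  assumes hered: "\<And>p k k'. k \<in> S p \<Longrightarrow> k' \<in> children k \<Longrightarrow> k' \<in> S (Suc p)"
    and q: "0 < q" "1 < 2 ^ CARD('n) * q" and "0 < c"
    and part: "\<And>p k. k \<in> indices p \<Longrightarrow> \<exists>i. c * q ^ p \<le> cap q (S (p + i)) i p k"
    and "k \<in> indices p"
  shows "\<exists>i. q ^ p \<le> cap q (S (p + i)) i p k"
proof -
  define b where "b = 2 ^ CARD('n) * q"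
  have b: "1 < b"
    using q b_def by simp
  have le: "cap q (S (p + i)) i p k \<le> cap q (S (p + j)) j p k" if "i \<le> j" for i j p k
    using hered q that by (intro cap_mono_depth) auto
  have iter: "\<exists>i. min 1 (c * b ^ n) * q ^ p \<le> cap q (S (p + i)) i p k" if "k \<in> indices p" for n p k
    using that
  proof (induction n arbitrary: p k)
    case 0
    obtain i where "c * q ^ p \<le> cap q (S (p + i)) i p k"
      using part[OF 0] by auto
    moreover have "min 1 c * q ^ p \<le> c * q ^ p"
      using q by (intro mult_right_mono) auto
    ultimately have "min 1 (c * b ^ 0) * q ^ p \<le> cap q (S (p + i)) i p k"
      by simp
    then show ?case ..
  next
    case (Suc n)
    \<comment> \<open>The children may reach their proportion at different depths; monotonicity in
      the depth lets the largest one serve all of them.\<close>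
    have "\<exists>i. \<forall>k'\<in>children k. min 1 (c * b ^ n) * q ^ Suc p \<le> cap q (S (Suc p + i)) i (Suc p) k'"
    proof -
      have "\<forall>k'\<in>children k. \<exists>i. min 1 (c * b ^ n) * q ^ Suc p \<le> cap q (S (Suc p + i)) i (Suc p) k'"
        using Suc.IH children_indices[OF Suc.prems] by blast
      then obtain I where I: "\<And>k'. k' \<in> children k \<Longrightarrow>
          min 1 (c * b ^ n) * q ^ Suc p \<le> cap q (S (Suc p + I k')) (I k') (Suc p) k'"
        by metis
      define i where "i = Max (I ` children k)"
      have "min 1 (c * b ^ n) * q ^ Suc p \<le> cap q (S (Suc p + i)) i (Suc p) k'" if "k' \<in> children k" for k'
        using I[OF that] le[of "I k'" i "Suc p" k'] that unfolding i_def
        by (meson Max_ge finite_children finite_imageI image_eqI order_trans)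
      then show ?thesis
        by blast
    qed
    then obtain i where i: "\<And>k'. k' \<in> children k \<Longrightarrow>
        min 1 (c * b ^ n) * q ^ Suc p \<le> cap q (S (Suc p + i)) i (Suc p) k'"
      by blast
    have "min 1 (c * b ^ Suc n) * q ^ p \<le> (b * min 1 (c * b ^ n)) * q ^ p"
    proof (intro mult_right_mono)
      have "b * min 1 (c * b ^ n) = min b (c * b ^ Suc n)"
        using b by (simp add: min_mult_distrib_left mult_ac)
      then show "min 1 (c * b ^ Suc n) \<le> b * min 1 (c * b ^ n)"
        using b by auto
    qed (use q in auto)
    also have "\<dots> = (\<Sum>k'\<in>children k. min 1 (c * b ^ n) * q ^ Suc p)"
      by (simp add: b_def)
    also have "\<dots> \<le> (\<Sum>k'\<in>children k. cap q (S (Suc p + i)) i (Suc p) k')"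
      by (intro sum_mono i)
    finally have "min 1 (c * b ^ Suc n) * q ^ p \<le> cap q (S (p + Suc i)) (Suc i) p k"
      using q by (auto intro: mult_left_le_one_le)
    then show ?case
      by blast
  qed
  obtain n where "1 / c < b ^ n"
    using b real_arch_pow by blast
  then have "min 1 (c * b ^ n) = 1"
    using \<open>0 < c\<close> by (simp add: min_def field_simps)
  then show ?thesis
    using iter[OF \<open>k \<in> indices p\<close>, of n] by simp
qed

section \<open>Countable intersections of open sets of full content\<close>

lemma dyadic_cube_eq:
  "dyadic_cube p k = {x. \<forall>i. real (k i) / 2 ^ p \<le> x $ i \<and> x $ i \<le> (real (k i) + 1) / 2 ^ p}"
  by (auto simp: dyadic_cube_def dyadic_corner_def mem_box_cart add.commute)

lemma compact_dyadic_cube: "compact (dyadic_cube p k)"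
  by (simp add: dyadic_cube_def)

lemma dyadic_corner_mem: "dyadic_corner p k \<in> dyadic_cube p k"
  by (auto simp: dyadic_cube_eq dyadic_corner_def field_simps)

lemma dyadic_cube_subset_ancestor: "dyadic_cube (p + m) l \<subseteq> dyadic_cube p (ancestor m l)"
proof -
  have "real (l i div 2 ^ m) / 2 ^ p \<le> real (l i) / 2 ^ (p + m)"
    "(real (l i) + 1) / 2 ^ (p + m) \<le> (real (l i div 2 ^ m) + 1) / 2 ^ p" for i
  proof -
    have "l i div 2 ^ m * 2 ^ m \<le> l i"
      by simp
    then have "real (l i div 2 ^ m) * 2 ^ m \<le> real (l i)"
      using of_nat_mono[of "l i div 2 ^ m * 2 ^ m" "l i", where 'a = real] by (simp add: algebra_simps)
    then have "real (l i div 2 ^ m) * 2 ^ m / 2 ^ (p + m) \<le> real (l i) / 2 ^ (p + m)"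
      by (intro divide_right_mono) auto
    then show "real (l i div 2 ^ m) / 2 ^ p \<le> real (l i) / 2 ^ (p + m)"
      by (simp add: power_add)
    have "l i + 1 \<le> (l i div 2 ^ m + 1) * 2 ^ m"
      using dividend_less_div_times[of "2 ^ m" "l i"] by (simp add: algebra_simps)
    then have "real (l i) + 1 \<le> (real (l i div 2 ^ m) + 1) * 2 ^ m"
      using of_nat_mono[of "l i + 1" "(l i div 2 ^ m + 1) * 2 ^ m", where 'a = real] by (simp add: algebra_simps)
    then have "(real (l i) + 1) / 2 ^ (p + m) \<le> (real (l i div 2 ^ m) + 1) * 2 ^ m / 2 ^ (p + m)"
      by (intro divide_right_mono) auto
    then show "(real (l i) + 1) / 2 ^ (p + m) \<le> (real (l i div 2 ^ m) + 1) / 2 ^ p"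
      by (simp add: power_add)
  qed
  then show ?thesis
    unfolding dyadic_cube_eq ancestor_def by (auto intro: order_trans)
qed

definition cubes_in :: "(real^'n) set \<Rightarrow> nat \<Rightarrow> ('n::finite \<Rightarrow> nat) set" where
  "cubes_in G p = {k. dyadic_cube p k \<subseteq> G}"

lemma cubes_in_children: "k \<in> cubes_in G p \<Longrightarrow> k' \<in> children k \<Longrightarrow> k' \<in> cubes_in G (Suc p)"
  using dyadic_cube_subset_ancestor[of p 1 k']
  by (auto simp: cubes_in_def children_def parent_eq_ancestor)

section \<open>From covers by arbitrary sets to covers by dyadic cubes\<close>

lemma infnorm_le_inf_diameter:
  assumes "bounded U" "x \<in> U" "y \<in> U"
  shows "infnorm (x - y) \<le> inf_diameter U"
proof -
  obtain B where B: "\<And>x. x \<in> U \<Longrightarrow> norm x \<le> B"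
    using assms(1) by (auto simp: bounded_iff)
  have "infnorm (u - v) \<le> 2 * B" if "u \<in> U" "v \<in> U" for u v
    using infnorm_le_norm[of "u - v"] norm_triangle_ineq4[of u v] B[OF that(1)] B[OF that(2)] by linarith
  then have "bdd_above ((\<lambda>(x, y). infnorm (x - y)) ` (U \<times> U))"
    by (intro bdd_aboveI[of _ "2 * B"]) auto
  then show ?thesis
    using assms cSUP_upper[of "(x, y)" "U \<times> U" "\<lambda>(x, y). infnorm (x - y)"]
    by (auto simp: inf_diameter_def)
qed

lemma inf_diameter_nonneg: "bounded U \<Longrightarrow> 0 \<le> inf_diameter U"
  using infnorm_le_inf_diameter[of U] infnorm_pos_le order_trans
  by (metis all_not_in_conv inf_diameter_def order_refl)

lemma hausdorff_measure_mono:
  assumes "E \<subseteq> F"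
  shows "hausdorff_measure s E \<le> hausdorff_measure s F"
proof -
  have "hausdorff_premeasure \<delta> s E \<le> hausdorff_premeasure \<delta> s F" for \<delta>
    unfolding hausdorff_premeasure_def using assms by (intro INF_superset_mono Collect_mono) auto
  then show ?thesis
    unfolding hausdorff_measure_def by (intro SUP_mono') auto
qed

text \<open>Replaces a positive diameter t by a dyadic scale at most twice as large;
  \<open>t \<le> 1\<close> keeps the generation nonnegative. The error \<open>e\<close> pays for t =
  0, where \<open>0 powr s\<close> is 0 but a dyadic cube still has positive cost.\<close>

lemma ex_scale:
  fixes t s e :: real
  assumes "0 \<le> t" "t \<le> 1" "0 < s" "0 < e"
  shows "\<exists>p. t \<le> (1 / 2) ^ p \<and> (2 powr - s) ^ p \<le> 2 powr s * t powr s + e"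
proof (cases "t = 0")
  case True
  have "2 powr - s < (1::real)"
    using assms powr_less_cancel_iff[of 2 "- s" 0] by simp
  then obtain p where "(2 powr - s) ^ p < e"
    using real_arch_pow_inv[OF \<open>0 < e\<close>] by blast
  with True show ?thesis
    by (intro exI[of _ p]) auto
next
  case False
  have "\<exists>p. (1 / 2) ^ p < t"
    using real_arch_pow_inv[of t "1 / 2"] False assms by auto
  define p where "p = (LEAST p. (1 / 2) ^ p < t)"
  have p: "(1 / 2) ^ p < t"
    unfolding p_def by (rule LeastI_ex) fact
  have "p \<noteq> 0"
    using p assms by (intro notI) simp
  then obtain m where m: "p = Suc m"
    using not0_implies_Suc by blast
  have "t \<le> (1 / 2) ^ m"
    using not_less_Least[of m "\<lambda>p. (1 / 2) ^ p < t"] m by (simp add: p_def not_less)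
  moreover have "(2 powr - s) ^ m = 2 powr s * ((1 / 2) ^ p) powr s"
  proof -
    have "(2 powr - s) ^ m = (2::real) powr (- s * real m)"
      by (simp add: powr_power mult.commute)
    also have "\<dots> = 2 powr s * (2 powr (- real p)) powr s"
      by (simp add: m powr_powr powr_add[symmetric] algebra_simps)
    also have "2 powr (- real p) = ((1 / 2) ^ p :: real)"
      by (simp add: powr_minus powr_realpow power_one_over inverse_eq_divide)
    finally show ?thesis .
  qed
  moreover have "((1 / 2) ^ p) powr s \<le> t powr s"
    using p assms by (intro powr_mono2) auto
  ultimately show ?thesis
    using assms by (intro exI[of _ m]) (auto intro: add_increasing2)
qed

text \<open>After scaling by \<open>2 ^ p\<close>, each index of a cube meeting the neighbourhood
  lies between floor - 3 and floor + 2 of the coordinate of one fixed point of \<open>U\<close>. The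
  window of length 8 leaves room for the truncated subtraction in \<open>a\<close>. The
  neighbourhood is there because a compactness argument needs open sets.\<close>

lemma card_cubes_meeting:
  fixes U :: "(real^'n) set"
  assumes "\<And>x y i. x \<in> U \<Longrightarrow> y \<in> U \<Longrightarrow> \<bar>x $ i - y $ i\<bar> \<le> (1 / 2) ^ p"
  defines "T \<equiv> {k. dyadic_cube p k \<inter> (\<Union>u\<in>U. ball u ((1 / 2) ^ p)) \<noteq> {}}"
  shows "finite T" "card T \<le> 8 ^ CARD('n)"
proof -
  have "finite T \<and> card T \<le> 8 ^ CARD('n)"
  proof (cases "U = {}")
    case False
    then obtain v where v: "v \<in> U"
      by blast
    define a where "a i = nat \<lfloor>2 ^ p * v $ i\<rfloor> - 3" for i
    have "k i \<in> {a i..<a i + 8}" if k: "k \<in> T" for k i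
    proof -
      obtain y u where y: "y \<in> dyadic_cube p k" "u \<in> U" "y \<in> ball u ((1 / 2) ^ p)"
        using k unfolding T_def by blast
      have "\<bar>y $ i - u $ i\<bar> \<le> (1 / 2) ^ p"
        using component_le_norm_cart[of "y - u" i] y(3) by (simp add: dist_norm norm_minus_commute)
      moreover have "\<bar>u $ i - v $ i\<bar> \<le> (1 / 2) ^ p"
        using assms(1) y v by blast
      ultimately have "\<bar>y $ i - v $ i\<bar> \<le> 2 * (1 / 2) ^ p"
        by linarith
      then have "2 ^ p * \<bar>y $ i - v $ i\<bar> \<le> 2 ^ p * (2 * (1 / 2) ^ p)"
        by (intro mult_left_mono) auto
      then have "\<bar>2 ^ p * y $ i - 2 ^ p * v $ i\<bar> \<le> 2"
        by (simp add: abs_mult right_diff_distrib[symmetric] power_one_over)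
      moreover have "real (k i) \<le> 2 ^ p * y $ i" "2 ^ p * y $ i \<le> real (k i) + 1"
        using y(1) by (auto simp: dyadic_cube_eq field_simps)
      ultimately have "real (k i) \<le> 2 ^ p * v $ i + 2" "2 ^ p * v $ i \<le> real (k i) + 3"
        by auto
      then have "int (k i) \<le> \<lfloor>2 ^ p * v $ i\<rfloor> + 2" "\<lfloor>2 ^ p * v $ i\<rfloor> \<le> int (k i) + 3"
        by linarith+
      then show ?thesis
        unfolding a_def atLeastLessThan_iff by linarith
    qed
    then have sub: "T \<subseteq> PiE UNIV (\<lambda>i. {a i..<a i + 8})"
      by (auto simp: PiE_def Pi_def)
    have fin: "finite (PiE (UNIV :: 'n set) (\<lambda>i. {a i..<a i + 8}))"
      by (intro finite_PiE) auto
    show ?thesis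
      using finite_subset[OF sub fin] card_mono[OF fin sub] by (simp add: card_PiE)
  qed (simp add: T_def)
  then show "finite T" "card T \<le> 8 ^ CARD('n)"
    by auto
qed

lemma sum_UN_le:
  fixes f :: "'a \<Rightarrow> real"
  assumes "finite I" "\<And>i. i \<in> I \<Longrightarrow> finite (T i)" "\<And>x. 0 \<le> f x"
  shows "sum f (\<Union>i\<in>I. T i) \<le> (\<Sum>i\<in>I. sum f (T i))"
  using assms(1,2)
proof (induction I rule: finite_induct)
  case (insert i I)
  have "sum f (\<Union>i\<in>insert i I. T i) \<le> sum f (T i) + sum f (\<Union>i\<in>I. T i)"
    using insert.prems insert.hyps assms(3) by (simp add: sum_Un sum_nonneg)
  with insert show ?case
    by simp
qed simp

text \<open>A cheap cover of the null compact intersection is thickened to open sets and reduced to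
  finitely many; by nestedness these already cover some \<open>K M\<close>. The last clause speaks
  of all cubes of generation g through y: a point on a common face lies in several, and the ancestor
  of a given leaf has to be among those in \<open>C\<close>.\<close>

lemma ex_content_cover:
  fixes K :: "nat \<Rightarrow> (real^'n) set"
  assumes K: "\<And>n. compact (K n)" "\<And>n. K (Suc n) \<subseteq> K n" and "0 < s" "0 < e"
    and zero: "hausdorff_measure s (\<Inter>n. K n) = 0"
  shows "\<exists>C m M. finite C \<and> (\<Sum>(g, k)\<in>C. (2 powr - s) ^ g) \<le> e \<and>
    (\<forall>n\<ge>M. \<forall>y\<in>K n. \<exists>g\<le>m. \<forall>k. y \<in> dyadic_cube g k \<longrightarrow> (g, k) \<in> C)"
proof -
  define q where "q = (2::real) powr - s"
  \<comment> \<open>Each covering set is replaced by at most 8^d cubes, each costing at most 2^s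
    diam^s plus an error; the errors \<open>e' * (1 / 2) ^ Suc n\<close> sum to at most
    \<open>e'\<close>.\<close>
  define B where "B = (8::real) ^ CARD('n) * (2 powr s + 1)"
  have B: "0 < B"
    unfolding B_def by (intro mult_pos_pos add_pos_pos) auto
  define e' where "e' = e / B"
  have e': "0 < e'"
    using B \<open>0 < e\<close> by (simp add: e'_def)
  \<comment> \<open>The level 1 suffices: it supplies the diameter bound under which dyadic scales
    are chosen.\<close>
  have "hausdorff_premeasure 1 s (\<Inter>n. K n) \<le> hausdorff_measure s (\<Inter>n. K n)"
    unfolding hausdorff_measure_def by (intro SUP_upper) auto
  then have "hausdorff_premeasure 1 s (\<Inter>n. K n) < ennreal e'"
    using zero e' by simp
  then obtain U where U: "(\<Inter>n. K n) \<subseteq> (\<Union>n. U n)" "\<And>n. bounded (U n)" "\<And>n. inf_diameter (U n) \<le> 1"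
    and U_sum: "(\<Sum>n. ennreal (inf_diameter (U n) powr s)) < ennreal e'"
    unfolding hausdorff_premeasure_def INF_less_iff by blast
  have "\<exists>p. inf_diameter (U n) \<le> (1 / 2) ^ p \<and>
      q ^ p \<le> 2 powr s * inf_diameter (U n) powr s + e' * (1 / 2) ^ Suc n" for n
    unfolding q_def using U inf_diameter_nonneg e' \<open>0 < s\<close> by (intro ex_scale) auto
  then obtain p where p: "\<And>n. inf_diameter (U n) \<le> (1 / 2) ^ p n"
    "\<And>n. q ^ p n \<le> 2 powr s * inf_diameter (U n) powr s + e' * (1 / 2) ^ Suc n"
    by metis
  define W where "W n = (\<Union>u\<in>U n. ball u ((1 / 2) ^ p n))" for n
  define T where "T n = {k. dyadic_cube (p n) k \<inter> W n \<noteq> {}}" for n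
  have open_W: "open (W n)" for n
    by (auto simp: W_def)
  have T: "finite (T n)" "card (T n) \<le> 8 ^ CARD('n)" for n
  proof -
    have "\<bar>x $ i - y $ i\<bar> \<le> (1 / 2) ^ p n" if "x \<in> U n" "y \<in> U n" for x y i
      using component_le_infnorm_cart[of "x - y" i] infnorm_le_inf_diameter[OF U(2) that] p(1)[of n] by simp
    then show "finite (T n)" "card (T n) \<le> 8 ^ CARD('n)"
      unfolding T_def W_def by (intro card_cubes_meeting; blast)+
  qed
  have "(\<Inter>n. K n) \<subseteq> (\<Union>n. W n)"
    using U(1) by (force simp: W_def)
  moreover have "compact (\<Inter>n. K n)"
    using K by (intro compact_Inter) auto
  ultimately obtain I where I: "finite I" "(\<Inter>n. K n) \<subseteq> (\<Union>n\<in>I. W n)"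
    using open_W by (metis compactE_image subset_UNIV)
  have antimono: "K n \<subseteq> K m" if "m \<le> n" for m n
    using lift_Suc_antimono_le[of K m n] K(2) that by blast
  have "\<exists>M. K M \<subseteq> (\<Union>n\<in>I. W n)"
  proof (rule ccontr)
    assume "\<not> ?thesis"
    then have "(\<Inter>n. K n - (\<Union>n\<in>I. W n)) \<noteq> {}"
    proof (intro compact_nest)
      show "K n - (\<Union>i\<in>I. W i) \<subseteq> K m - (\<Union>i\<in>I. W i)" if "m \<le> n" for m n
        using antimono[OF that] by blast
    qed (use K(1) open_W in \<open>auto intro!: compact_diff open_UN\<close>)
    with I(2) show False
      by blast
  qed
  then obtain M where M: "K M \<subseteq> (\<Union>n\<in>I. W n)"
    by blast
  define C where "C = (\<Union>n\<in>I. {p n} \<times> T n)"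
  have "(\<Sum>(g, k)\<in>C. q ^ g) \<le> (\<Sum>n\<in>I. \<Sum>(g, k)\<in>{p n} \<times> T n. q ^ g)"
    unfolding C_def using I(1) T(1)
    by (intro sum_UN_le) (auto simp: q_def)
  also have "\<dots> = (\<Sum>n\<in>I. card (T n) * q ^ p n)"
    by (simp add: sum.cartesian_product[symmetric])
  also have "\<dots> \<le> (\<Sum>n\<in>I. 8 ^ CARD('n) * (2 powr s * inf_diameter (U n) powr s + e' * (1 / 2) ^ Suc n))"
  proof (intro sum_mono mult_mono p(2))
    show "real (card (T n)) \<le> 8 ^ CARD('n)" for n
      using T(2)[of n] by (metis of_nat_le_iff of_nat_numeral of_nat_power)
  qed (auto simp: q_def)
  also have "\<dots> = 8 ^ CARD('n) * (2 powr s * (\<Sum>n\<in>I. inf_diameter (U n) powr s) + e' * (\<Sum>n\<in>I. (1 / 2) ^ Suc n))"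
    by (simp add: sum_distrib_left sum.distrib algebra_simps)
  also have "\<dots> \<le> 8 ^ CARD('n) * (2 powr s * e' + e' * 1)"
  proof (intro mult_left_mono add_mono)
    have "ennreal (\<Sum>n\<in>I. inf_diameter (U n) powr s) = (\<Sum>n\<in>I. ennreal (inf_diameter (U n) powr s))"
      by simp
    also have "\<dots> \<le> (\<Sum>n. ennreal (inf_diameter (U n) powr s))"
      using I(1) by (intro sum_le_suminf) auto
    also note U_sum
    finally show "(\<Sum>n\<in>I. inf_diameter (U n) powr s) \<le> e'"
      by (simp add: ennreal_less_iff sum_nonneg)
    show "(\<Sum>n\<in>I. (1 / 2 :: real) ^ Suc n) \<le> 1"
      using sum_le_suminf[of "\<lambda>n. (1 / 2 :: real) ^ Suc n" I] I(1) power_half_series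
      by (auto simp: sums_iff)
  qed (use e' in auto)
  also have "\<dots> = e"
  proof -
    have "8 ^ CARD('n) * (2 powr s * e' + e' * 1) = B * e'"
      by (simp add: B_def algebra_simps)
    then show ?thesis
      using B by (simp add: e'_def)
  qed
  finally have C_sum: "(\<Sum>(g, k)\<in>C. q ^ g) \<le> e" .
  have fin_C: "finite C"
    using I(1) T(1) by (auto simp: C_def)
  have "\<exists>g\<le>Max (p ` I). \<forall>k. y \<in> dyadic_cube g k \<longrightarrow> (g, k) \<in> C" if "M \<le> n" "y \<in> K n" for n y
  proof -
    have "y \<in> K M"
      using that antimono by blast
    then obtain i where i: "i \<in> I" "y \<in> W i"
      using M by blast
    then show ?thesis
      using I(1) by (intro exI[of _ "p i"]) (auto simp: C_def T_def)
  qed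
  then show ?thesis
    using C_sum fin_C unfolding q_def by blast
qed

text \<open>Successive refinements keep the content of the root at 1, and the unions of the chosen
  cubes are nested compact sets \<open>K N\<close> whose intersection lies in every
  \<open>G N\<close>. If this were null, a dyadic cover of cost 1/2 would also cover the leaves of a
  deep \<open>K n\<close>, whose content is 1.\<close>

theorem hausdorff_measure_Inter_open:
  fixes G :: "nat \<Rightarrow> (real^'n) set" and s :: real
  assumes s: "0 < s" "s < CARD('n)"
    and full: "\<And>N p k. k \<in> indices p \<Longrightarrow>
      \<exists>i. (2 powr - s) ^ p \<le> cap (2 powr - s) (cubes_in (G N) (p + i)) i p k"
  shows "hausdorff_measure s (\<Inter>N. G N) \<noteq> 0"
proof
  assume zero: "hausdorff_measure s (\<Inter>N. G N) = 0"
  define q where "q = (2::real) powr - s"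
  have "2 ^ CARD('n) * q = 2 powr (CARD('n) - s)"
    by (simp add: q_def powr_diff powr_minus powr_realpow field_simps)
  then have q: "0 < q" "1 \<le> 2 ^ CARD('n) * q"
    using s by (auto simp: q_def ge_one_powr_ge_zero)
  define root :: "'n \<Rightarrow> nat" where "root = (\<lambda>_. 0)"
  \<comment> \<open>The index is shifted: stage 0 is the root alone, and stage \<open>Suc N\<close>
    takes care of \<open>G N\<close>. As the root costs \<open>q ^ 0 = 1\<close>, the content bound
    says that nothing has been lost.\<close>
  define P where "P N X \<longleftrightarrow> (case X of (j, A) \<Rightarrow> A \<subseteq> indices j \<and> 1 \<le> cap q A j 0 root \<and>
    (case N of 0 \<Rightarrow> True | Suc N \<Rightarrow> A \<subseteq> cubes_in (G N) j))" for N X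
  define R where "R X X' \<longleftrightarrow> (case X of (j, A) \<Rightarrow> case X' of (j', A') \<Rightarrow>
    j < j' \<and> (\<forall>l\<in>A'. ancestor (j' - j) l \<in> A))" for X X' :: "nat \<times> ('n \<Rightarrow> nat) set"
  have "\<exists>f. \<forall>N. P N (f N) \<and> R (f N) (f (Suc N))"
  proof (rule dependent_nat_choice)
    show "\<exists>X. P 0 X"
      by (rule exI[of _ "(0, {root})"]) (auto simp: P_def indices_def root_def)
  next
    fix X N assume "P N X"
    then obtain j A where X: "X = (j, A)" "A \<subseteq> indices j" "1 \<le> cap q A j 0 root"
      by (auto simp: P_def)
    have "\<forall>k\<in>A. \<exists>i. q ^ j \<le> cap q (cubes_in (G N) (j + i)) i j k"
      using full X(2) by (auto simp: q_def)
    then obtain I where I: "\<And>k. k \<in> A \<Longrightarrow> q ^ j \<le> cap q (cubes_in (G N) (j + I k)) (I k) j k"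
      by metis
    have fin: "finite A"
      using finite_subset[OF X(2)] by simp
    \<comment> \<open>The sum dominates every \<open>I k\<close>; \<open>Suc\<close> makes the
      generations strictly increase, so that they eventually pass the depth \<open>m\<close> of the
      finite cover.\<close>
    define i where "i = Suc (\<Sum>k\<in>A. I k)"
    define A' where "A' = {l \<in> indices (j + i). ancestor i l \<in> A \<and> l \<in> cubes_in (G N) (j + i)}"
    have "q ^ (0 + j) \<le> cap q A' i (0 + j) k" if k: "k \<in> A" for k
    proof -
      have "I k \<le> i"
        unfolding i_def using member_le_sum[of k A I] fin k by simp
      have "q ^ j \<le> cap q (cubes_in (G N) (j + I k)) (I k) j k"
        by (rule I[OF k])
      also have "\<dots> \<le> cap q (cubes_in (G N) (j + i)) i j k"
        using q \<open>I k \<le> i\<close> cubes_in_children by (intro cap_mono_depth) auto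
      also have "\<dots> \<le> cap q A' i j k"
      proof (rule cap_mono)
        fix l assume l: "l \<in> cubes_in (G N) (j + i)" "ancestor i l = k"
        have "l a < 2 ^ (j + i)" for a
        proof -
          have "l a div 2 ^ i < 2 ^ j"
            using l(2) k X(2) by (auto simp: indices_def ancestor_def)
          then show ?thesis
            by (simp add: div_less_iff_less_mult power_add)
        qed
        then show "l \<in> A'"
          using l k by (auto simp: A'_def indices_def)
      qed (use q in auto)
      finally show ?thesis
        by simp
    qed
    then have "cap q A j 0 root \<le> cap q A' (j + i) 0 root"
      using q by (intro cap_compose) auto
    then have "P (Suc N) (j + i, A') \<and> R X (j + i, A')"
      using X(1,3) by (auto simp: P_def R_def A'_def i_def)
    then show "\<exists>X'. P (Suc N) X' \<and> R X X'" ..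
  qed
  then obtain f where f: "\<And>N. P N (f N)" "\<And>N. R (f N) (f (Suc N))"
    by blast
  define j where "j N = fst (f N)" for N
  define A where "A N = snd (f N)" for N
  have A: "A N \<subseteq> indices (j N)" "1 \<le> cap q (A N) (j N) 0 root" "A (Suc N) \<subseteq> cubes_in (G N) (j (Suc N))"
    and j: "j N < j (Suc N)" and anc: "l \<in> A (Suc N) \<Longrightarrow> ancestor (j (Suc N) - j N) l \<in> A N" for N l
    using f(1)[of N] f(1)[of "Suc N"] f(2)[of N] by (auto simp: P_def R_def j_def A_def split_beta)
  define K where "K N = (\<Union>l\<in>A N. dyadic_cube (j N) l)" for N
  have "compact (K N)" for N
    unfolding K_def using A(1) finite_subset[OF A(1)] by (intro compact_UN compact_dyadic_cube) auto
  moreover have K_Suc: "K (Suc N) \<subseteq> K N" for N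
  proof
    fix y assume "y \<in> K (Suc N)"
    then obtain l where l: "l \<in> A (Suc N)" "y \<in> dyadic_cube (j (Suc N)) l"
      by (auto simp: K_def)
    then have "y \<in> dyadic_cube (j N) (ancestor (j (Suc N) - j N) l)"
      using dyadic_cube_subset_ancestor[of "j N" "j (Suc N) - j N" l] j[of N] by auto
    then show "y \<in> K N"
      using anc[OF l(1)] by (auto simp: K_def)
  qed
  moreover have "hausdorff_measure s (\<Inter>N. K N) = 0"
  proof -
    have "K (Suc N) \<subseteq> G N" for N
      using A(3)[of N] by (auto simp: K_def cubes_in_def)
    then have "(\<Inter>N. K N) \<subseteq> (\<Inter>N. G N)"
      by blast
    then have "hausdorff_measure s (\<Inter>N. K N) \<le> hausdorff_measure s (\<Inter>N. G N)"
      by (rule hausdorff_measure_mono)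
    with zero show ?thesis
      by simp
  qed
  ultimately have "\<exists>C m M. finite C \<and> (\<Sum>(g, k)\<in>C. q ^ g) \<le> 1 / 2 \<and>
      (\<forall>n\<ge>M. \<forall>y\<in>K n. \<exists>g\<le>m. \<forall>k. y \<in> dyadic_cube g k \<longrightarrow> (g, k) \<in> C)"
    unfolding q_def using s by (intro ex_content_cover) auto
  then obtain C m M where C: "finite C" "(\<Sum>(g, k)\<in>C. q ^ g) \<le> 1 / 2"
    "\<And>n y. M \<le> n \<Longrightarrow> y \<in> K n \<Longrightarrow> \<exists>g\<le>m. \<forall>k. y \<in> dyadic_cube g k \<longrightarrow> (g, k) \<in> C"
    by blast
  have "n \<le> j n" for n
    by (induction n) (use j Suc_leI le_less_trans in blast)+
  define n where "n = max m M"
  then have n: "m \<le> j n" "M \<le> n"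
    using \<open>\<And>n. n \<le> j n\<close>[of n] by auto
  have "cap q (A n) (j n) 0 root \<le>
      (\<Sum>(g, c) \<in> {(g, c) \<in> C. 0 \<le> g \<and> ancestor (g - 0) c = root}. q ^ g)"
  proof (rule cap_le_sum_cover)
    fix l assume l: "l \<in> A n"
    then have "dyadic_corner (j n) l \<in> K n"
      using dyadic_corner_mem by (auto simp: K_def)
    then obtain g where g: "g \<le> m" "\<And>k. dyadic_corner (j n) l \<in> dyadic_cube g k \<Longrightarrow> (g, k) \<in> C"
      using C(3) n by blast
    then have "dyadic_corner (j n) l \<in> dyadic_cube g (ancestor (j n - g) l)"
      using dyadic_cube_subset_ancestor[of g "j n - g" l] dyadic_corner_mem[of "j n" l] n by auto
    with g n show "\<exists>g. 0 \<le> g \<and> g \<le> 0 + j n \<and> (g, ancestor (0 + j n - g) l) \<in> C"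
      by (intro exI[of _ g]) auto
  qed (use q C in auto)
  also have "\<dots> \<le> (\<Sum>(g, k)\<in>C. q ^ g)"
    using C(1) q by (intro sum_mono2) auto
  finally show False
    using A(2)[of n] C(2) by simp
qed

section \<open>Geometry of a single rectangle\<close>

text \<open>The right-hand side minus the left-hand side is piecewise linear in \<open>t\<close> with breakpoints
  \<open>\<tau> k\<close>, where it is nonnegative by assumption.\<close>

lemma mult_le_add_sum_max:
  fixes \<tau> :: "'n::{finite,linorder} \<Rightarrow> real" and s :: real
  assumes "mono \<tau>" "0 < s" "s \<le> CARD('n)"
    and bound: "\<And>k. s * \<tau> k \<le> a + (\<Sum>j\<in>{..k}. \<tau> k - \<tau> j)"
  shows "s * t \<le> a + (\<Sum>j\<in>UNIV. max 0 (t - \<tau> j))"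
proof -
  define J where "J = {j. \<tau> j \<le> t}"
  have "(\<Sum>j\<in>UNIV. max 0 (t - \<tau> j)) = (\<Sum>j\<in>J. t - \<tau> j)"
    unfolding J_def by (intro sum.mono_neutral_cong_right) auto
  also have "\<dots> = card J * t - sum \<tau> J"
    by (simp add: sum_subtractf)
  finally have eq: "(\<Sum>j\<in>UNIV. max 0 (t - \<tau> j)) = card J * t - sum \<tau> J" .
  \<comment> \<open>At t the right-hand side has slope \<open>card J\<close>, the left-hand side
    slope s. If \<open>s \<le> card J\<close>, the difference does not increase on moving left to
    the breakpoint of \<open>Max J\<close>; otherwise it does not increase on moving right to that
    of \<open>Min (- J)\<close>, which exists because \<open>s \<le> CARD('n)\<close>.\<close>
  show ?thesis
  proof (cases "s \<le> card J")
    case True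
    then have "J \<noteq> {}"
      using \<open>0 < s\<close> by auto
    define k where "k = Max J"
    have k: "k \<in> J" "\<And>j. j \<in> J \<Longrightarrow> j \<le> k"
      unfolding k_def using \<open>J \<noteq> {}\<close> by auto
    have "J = {..k}"
      using k monoD[OF \<open>mono \<tau>\<close>] by (fastforce simp: J_def)
    then have "s * \<tau> k \<le> a + (card J * \<tau> k - sum \<tau> J)"
      using bound[of k] by (simp add: sum_subtractf)
    moreover have "0 \<le> (card J - s) * (t - \<tau> k)"
      using True k by (auto simp: J_def)
    ultimately show ?thesis
      unfolding eq by (simp add: algebra_simps)
  next
    case False
    then have "J \<noteq> UNIV"
      using \<open>s \<le> CARD('n)\<close> by auto
    then have "- J \<noteq> {}"
      by auto
    define k where "k = Min (- J)"
    have k: "k \<notin> J" "\<And>j. j \<notin> J \<Longrightarrow> k \<le> j"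
      unfolding k_def using \<open>- J \<noteq> {}\<close> Min_in[of "- J"] by auto
    have "j < k" if "j \<in> J" for j
      using that k(1) monoD[OF \<open>mono \<tau>\<close>, of k j] by (fastforce simp: J_def not_less)
    then have "J = {..<k}"
      using k(2) by (fastforce simp: not_less)
    then have "{..k} = insert k J"
      by auto
    then have "s * \<tau> k \<le> a + (card J * \<tau> k - sum \<tau> J)"
      using bound[of k] k(1) by (simp add: sum_subtractf algebra_simps)
    moreover have "0 \<le> (s - card J) * (\<tau> k - t)"
      using False k by (auto simp: J_def)
    ultimately show ?thesis
      unfolding eq by (simp add: algebra_simps)
  qed
qed

text \<open>Writing \<rho> = r^t turns \<open>min 1 (\<rho> / r powr \<tau> j)\<close> into
  \<open>r powr (max 0 (t - \<tau> j))\<close>, so the claim compares exponents, with the order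
  reversed by r < 1. The left side models the mass r^a of a ball times the share of its rectangle
  seen by a cube of side \<rho>.\<close>

lemma powr_mult_prod_min_le:
  fixes \<tau> :: "'n::{finite,linorder} \<Rightarrow> real" and s r \<rho> :: real
  assumes "mono \<tau>" "0 < s" "s \<le> CARD('n)"
    and bound: "\<And>k. s * \<tau> k \<le> a + (\<Sum>j\<in>{..k}. \<tau> k - \<tau> j)"
    and r: "0 < r" "r < 1" and \<rho>: "0 < \<rho>"
  shows "r powr a * (\<Prod>j\<in>UNIV. min 1 (\<rho> / r powr \<tau> j)) \<le> \<rho> powr s"
proof -
  define t where "t = ln \<rho> / ln r"
  have \<rho>_eq: "\<rho> = r powr t"
    using r \<rho> by (simp add: t_def powr_def)
  have "min 1 (\<rho> / r powr \<tau> j) = r powr (max 0 (t - \<tau> j))" for j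
  proof -
    have "\<rho> / r powr \<tau> j = r powr (t - \<tau> j)"
      by (simp add: \<rho>_eq powr_diff)
    moreover have "r powr (t - \<tau> j) \<le> r powr 0" if "\<tau> j \<le> t"
      using that r by (intro powr_mono') auto
    moreover have "r powr 0 \<le> r powr (t - \<tau> j)" if "t \<le> \<tau> j"
      using that r by (intro powr_mono') auto
    ultimately show ?thesis
      using r by (cases "\<tau> j \<le> t") (auto simp: min_def max_def)
  qed
  then have "r powr a * (\<Prod>j\<in>UNIV. min 1 (\<rho> / r powr \<tau> j)) = r powr (a + (\<Sum>j\<in>UNIV. max 0 (t - \<tau> j)))"
    using r by (simp add: powr_add powr_sum)
  also have "\<dots> \<le> r powr (s * t)"
    using mult_le_add_sum_max[OF assms(1-4), of t] r by (intro powr_mono') auto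
  also have "\<dots> = \<rho> powr s"
    by (simp add: \<rho>_eq powr_powr mult.commute)
  finally show ?thesis .
qed

section \<open>Affine charts of rectangles\<close>

definition rect_map :: "('n::finite \<Rightarrow> real) \<Rightarrow> real^'n \<Rightarrow> real \<Rightarrow> real^'n^'n \<Rightarrow> real^'n \<Rightarrow> real^'n" where
  "rect_map \<tau> x r Q y = x + Q *v (diag_matrix (\<lambda>i. r powr \<tau> i) *v y)"

text \<open>A compact box inside the open unit cube. Mass carried by its image stays at a positive
  distance from the complement of the interior of the rectangle.\<close>

definition core_box :: "(real^'n) set" where
  "core_box = cbox (\<chi> i. 1 / 4) (\<chi> i. 3 / 4)"

lemma rectangle_eq_image: "rectangle \<tau> x r Q = rect_map \<tau> x r Q ` cbox 0 1"
  by (auto simp: rectangle_def std_rectangle_def rect_map_def image_iff)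

lemma diag_matrix_component: "(diag_matrix a *v y) $ i = a i * y $ i"
  by (simp add: diag_matrix_def matrix_vector_mult_def if_distrib[of "\<lambda>z. z * _"] cong: if_cong)

lemma norm_orthogonal_matrix_mult:
  fixes Q :: "real^'n^'n"
  shows "orthogonal_matrix Q \<Longrightarrow> norm (Q *v y) = norm y"
  using orthogonal_transformation_norm[of "(*v) Q" y]
  by (simp add: orthogonal_transformation_matrix)

lemma rect_map_diff:
  "rect_map \<tau> x r Q y - rect_map \<tau> x r Q z = Q *v (diag_matrix (\<lambda>i. r powr \<tau> i) *v (y - z))"
  by (simp add: rect_map_def matrix_vector_mult_diff_distrib)

lemma rect_map_component_le:
  assumes "orthogonal_matrix Q"
  shows "r powr \<tau> i * \<bar>y $ i - z $ i\<bar> \<le> norm (rect_map \<tau> x r Q y - rect_map \<tau> x r Q z)"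
  using component_le_norm_cart[of "diag_matrix (\<lambda>i. r powr \<tau> i) *v (y - z)" i]
  by (simp add: rect_map_diff norm_orthogonal_matrix_mult[OF assms] diag_matrix_component abs_mult)

lemma continuous_on_rect_map: "continuous_on S (rect_map \<tau> x r Q)"
  unfolding rect_map_def
  by (intro continuous_intros linear_continuous_on_compose[OF _ matrix_vector_mul_linear]) 

lemma compact_core: "compact (rect_map \<tau> x r Q ` core_box)"
  unfolding core_box_def by (intro compact_continuous_image continuous_on_rect_map compact_cbox)

lemma core_box_bounds: "y \<in> core_box \<Longrightarrow> 1 / 4 \<le> y $ i \<and> y $ i \<le> 3 / 4"
  by (simp add: core_box_def mem_box_cart)

lemma core_box_subset_box: "core_box \<subseteq> box 0 (1 :: real^'n)"
proof
  fix y :: "real^'n" assume "y \<in> core_box"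
  then have "0 < y $ i \<and> y $ i < 1" for i
    using core_box_bounds[of y i] by linarith
  then show "y \<in> box 0 1"
    by (simp add: mem_box_cart)
qed

lemma core_box_subset: "core_box \<subseteq> cbox 0 1"
  using core_box_subset_box box_subset_cbox by blast

text \<open>The chart is an injective affine map, since \<open>Q\<close> preserves norms and no
  diagonal entry vanishes for \<open>0 < r\<close>; hence it maps the open unit cube onto an open
  set.\<close>

lemma core_subset_interior:
  assumes "0 < r" "orthogonal_matrix Q"
  shows "rect_map \<tau> x r Q ` core_box \<subseteq> interior (rectangle \<tau> x r Q)"
proof -
  define M where "M = (\<lambda>y. Q *v (diag_matrix (\<lambda>i. r powr \<tau> i) *v y))"
  have "linear M"
    unfolding M_def by (intro linear_compose[OF matrix_vector_mul_linear matrix_vector_mul_linear, unfolded o_def])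
  have "y = z" if "M y = M z" for y z
  proof -
    have "r powr \<tau> i * \<bar>y $ i - z $ i\<bar> \<le> 0" for i
      using rect_map_component_le[OF assms(2), of r \<tau> i y z 0] that by (simp add: M_def rect_map_def)
    then show ?thesis
      using assms(1) by (simp add: vec_eq_iff mult_le_0_iff not_le)
  qed
  then have "inj M"
    by (auto intro: injI)
  then have "open (M ` box 0 1)"
    using \<open>linear M\<close> linear_injective_imp_surjective by (intro open_surjective_linear_image) auto
  then have "open ((+) x ` M ` box 0 1)"
    by (rule open_translation)
  moreover have "(+) x ` M ` box 0 1 = rect_map \<tau> x r Q ` box 0 1"
    by (auto simp: M_def rect_map_def image_iff)
  moreover have "rect_map \<tau> x r Q ` box 0 1 \<subseteq> rectangle \<tau> x r Q"
    unfolding rectangle_eq_image using box_subset_cbox by blast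
  ultimately have "rect_map \<tau> x r Q ` box 0 1 \<subseteq> interior (rectangle \<tau> x r Q)"
    by (intro interior_maximal) auto
  then show ?thesis
    using core_box_subset_box by blast
qed

lemma rect_map_dist_le:
  fixes x y :: "real^'n" and r :: real
  assumes "orthogonal_matrix Q" "0 < r" "r \<le> 1" "\<And>i. 1 \<le> \<tau> i" "y \<in> cbox 0 1"
  shows "dist x (rect_map \<tau> x r Q y) \<le> CARD('n) * r"
proof -
  have "dist x (rect_map \<tau> x r Q y) = norm (diag_matrix (\<lambda>i. r powr \<tau> i) *v y)"
    by (simp add: rect_map_def dist_norm norm_orthogonal_matrix_mult[OF assms(1)])
  also have "\<dots> \<le> (\<Sum>i\<in>UNIV. \<bar>(diag_matrix (\<lambda>i. r powr \<tau> i) *v y) $ i\<bar>)"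
    by (rule norm_le_l1_cart)
  also have "\<dots> \<le> (\<Sum>i\<in>(UNIV :: 'n set). r)"
  proof (rule sum_mono)
    fix i
    have "r powr \<tau> i * \<bar>y $ i\<bar> \<le> r powr 1 * 1"
      using assms by (intro mult_mono powr_mono') (auto simp: mem_box_cart)
    then show "\<bar>(diag_matrix (\<lambda>i. r powr \<tau> i) *v y) $ i\<bar> \<le> r"
      using assms(2) by (simp add: diag_matrix_component abs_mult)
  qed
  finally show ?thesis
    by simp
qed

text \<open>The rotation preserves norms, so two points mapped into \<open>D\<close> differ in
  coordinate i by at most \<open>l * \<rho> / r powr \<tau> i\<close>. The preimage therefore lies
  in an axis-parallel box around any of its points, cut off by \<open>core_box\<close>, and the
  sides of this box are bounded factor by factor.\<close>

lemma measure_rect_map_vimage_le: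
  fixes D :: "(real^'n) set" and r l \<rho> :: real
  assumes "orthogonal_matrix Q" "0 < r" "1 \<le> l" "0 < \<rho>"
    and D: "\<And>z z'. z \<in> D \<Longrightarrow> z' \<in> D \<Longrightarrow> dist z z' \<le> l * \<rho>"
    and meas: "core_box \<inter> rect_map \<tau> x r Q -` D \<in> sets borel"
  shows "measure lborel (core_box \<inter> rect_map \<tau> x r Q -` D) \<le>
    (2 * l) ^ CARD('n) * (\<Prod>j\<in>UNIV. min 1 (\<rho> / r powr \<tau> j))"
proof (cases "core_box \<inter> rect_map \<tau> x r Q -` D = {}")
  case True
  then show ?thesis
    using assms by (auto intro!: mult_nonneg_nonneg prod_nonneg)
next
  case False
  then obtain y where y: "y \<in> core_box" "rect_map \<tau> x r Q y \<in> D"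
    by auto
  define h where "h i = l * \<rho> / r powr \<tau> i" for i
  have h: "0 \<le> h i" for i
    using assms by (simp add: h_def)
  define u v :: "real^'n" where "u = (\<chi> i. max (1 / 4) (y $ i - h i))" and "v = (\<chi> i. min (3 / 4) (y $ i + h i))"
  have yi: "1 / 4 \<le> y $ i" "y $ i \<le> 3 / 4" for i
    using y(1) by (auto simp: core_box_def mem_box_cart)
  have uv: "u $ i \<le> y $ i \<and> y $ i \<le> v $ i" for i
    unfolding u_def v_def vec_lambda_beta using yi[of i] h[of i] by (intro conjI) linarith+
  have "core_box \<inter> rect_map \<tau> x r Q -` D \<subseteq> cbox u v"
  proof
    fix z assume z: "z \<in> core_box \<inter> rect_map \<tau> x r Q -` D"
    have "\<bar>y $ i - z $ i\<bar> \<le> h i" for i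
    proof -
      have "r powr \<tau> i * \<bar>y $ i - z $ i\<bar> \<le> l * \<rho>"
        using rect_map_component_le[OF assms(1), of r \<tau> i y z x] D[of "rect_map \<tau> x r Q y" "rect_map \<tau> x r Q z"] y z
        by (auto simp: dist_norm)
      then show ?thesis
        using assms(2) by (simp add: h_def field_simps)
    qed
    moreover have "1 / 4 \<le> z $ i" "z $ i \<le> 3 / 4" for i
      using z by (auto simp: core_box_def mem_box_cart)
    ultimately show "z \<in> cbox u v"
      by (simp add: u_def v_def mem_box_cart abs_le_iff) (smt (verit))
  qed
  then have "measure lborel (core_box \<inter> rect_map \<tau> x r Q -` D) \<le> measure lborel (cbox u v)"
    using meas by (intro measure_mono_fmeasurable) auto
  also have "\<dots> = (\<Prod>i\<in>UNIV. v $ i - u $ i)"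
  proof -
    have "cbox u v \<noteq> {}"
      using uv by (metis empty_iff mem_box_cart(2))
    then show ?thesis
      by (rule content_cbox_cart)
  qed
  also have "\<dots> \<le> (\<Prod>i\<in>UNIV. (2 * l) * min 1 (\<rho> / r powr \<tau> i))"
  proof (rule prod_mono, safe)
    fix i
    show "0 \<le> v $ i - u $ i"
      using uv[of i] by linarith
    have "v $ i - u $ i \<le> 1" "v $ i - u $ i \<le> 2 * h i"
      using yi[of i] h[of i] by (auto simp: u_def v_def)
    then show "v $ i - u $ i \<le> 2 * l * min 1 (\<rho> / r powr \<tau> i)"
      using \<open>1 \<le> l\<close> by (auto simp: h_def min_def)
  qed
  also have "\<dots> = (2 * l) ^ CARD('n) * (\<Prod>j\<in>UNIV. min 1 (\<rho> / r powr \<tau> j))"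
    by (simp add: prod.distrib)
  finally show ?thesis .
qed

section \<open>Selection of disjoint balls\<close>

text \<open>Vitali's lemma is applied to radii \<open>3 * R n\<close>, so the tripled balls selected
  are disjoint and their fivefold enlargements, of radius \<open>15 * R n\<close>, still cover. The
  disjoint pieces \<open>V m\<close> let the mass near each selected ball be assigned to its
  rectangle without counting anything twice.\<close>

lemma ex_disjoint_family:
  fixes x :: "nat \<Rightarrow> 'a::euclidean_space"
  assumes "finite_measure \<nu>" and sets [measurable_cong]: "sets \<nu> = sets borel" and E [measurable]: "E \<in> sets borel"
    and R: "\<And>n. 0 < R n"
    and null: "measure \<nu> (E - (\<Union>n\<in>{N..}. cball (x n) (R n))) = 0"
    and pos: "0 < measure \<nu> E"
  shows "\<exists>F V. finite F \<and> F \<subseteq> {N..} \<and> disjoint_family_on V F \<and>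
    (\<forall>m\<in>F. V m \<in> sets borel \<and> V m \<subseteq> E \<inter> cball (x m) (15 * R m) \<and> cball (x m) (R m) \<inter> E \<noteq> {}) \<and>
    pairwise (\<lambda>m n. disjnt (cball (x m) (3 * R m)) (cball (x n) (3 * R n))) F \<and>
    measure \<nu> E / 2 \<le> (\<Sum>m\<in>F. measure \<nu> (V m))"
proof -
  interpret finite_measure \<nu> by fact
  define A where "A M = E \<inter> (\<Union>n\<in>{N..<M}. cball (x n) (R n))" for M
  have A_sets [measurable]: "A M \<in> sets \<nu>" for M
    unfolding A_def by measurable
  have "incseq A"
    unfolding A_def incseq_def by fastforce
  then have "(\<lambda>M. measure \<nu> (A M)) \<longlonglongrightarrow> measure \<nu> (\<Union>M. A M)"
    by (intro finite_Lim_measure_incseq) auto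
  moreover have "(\<Union>M. A M) = E \<inter> (\<Union>n\<in>{N..}. cball (x n) (R n))"
  proof -
    have "n \<in> {N..<Suc n}" if "N \<le> n" for n
      using that by auto
    then show ?thesis
      unfolding A_def by fastforce
  qed
  moreover have "measure \<nu> (E \<inter> (\<Union>n\<in>{N..}. cball (x n) (R n))) = measure \<nu> E"
  proof -
    have "measure \<nu> (E - (\<Union>n\<in>{N..}. cball (x n) (R n))) =
        measure \<nu> E - measure \<nu> (E \<inter> (\<Union>n\<in>{N..}. cball (x n) (R n)))"
      by (subst finite_measure_Diff') (use sets in auto)
    with null show ?thesis
      by simp
  qed
  ultimately have "(\<lambda>M. measure \<nu> (A M)) \<longlonglongrightarrow> measure \<nu> E"
    by simp
  \<comment> \<open>By continuity from below, finitely many balls capture more than half of the mass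
    of \<open>E\<close>.\<close>
  then have "eventually (\<lambda>M. measure \<nu> E / 2 < measure \<nu> (A M)) sequentially"
    using pos by (intro order_tendstoD(1)) auto
  then obtain M where M: "measure \<nu> E / 2 < measure \<nu> (A M)"
    by (meson eventually_happens sequentially_bot)
  \<comment> \<open>Only balls that meet \<open>E\<close> are kept, so that small rectangles
    attached to them stay near \<open>E\<close>, inside any cube that surrounds \<open>E\<close>
    with a margin.\<close>
  define K where "K = {n\<in>{N..<M}. cball (x n) (R n) \<inter> E \<noteq> {}}"
  have K: "finite K"
    by (simp add: K_def)
  have "A M \<subseteq> (\<Union>n\<in>K. cball (x n) (3 * R n))"
  proof
    fix y assume "y \<in> A M"
    then obtain n where n: "n \<in> {N..<M}" "y \<in> cball (x n) (R n)" "y \<in> E"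
      by (auto simp: A_def)
    then have "n \<in> K" "y \<in> cball (x n) (3 * R n)"
      using R[of n] by (auto simp: K_def)
    then show "y \<in> (\<Union>n\<in>K. cball (x n) (3 * R n))"
      by blast
  qed
  moreover have "0 < 3 * R n \<and> 3 * R n \<le> Max ((\<lambda>n. 3 * R n) ` K)" if "n \<in> K" for n
    using R that K by auto
  ultimately obtain F where F: "countable F" "F \<subseteq> K"
     "pairwise (\<lambda>i j. disjnt (cball (x i) (3 * R i)) (cball (x j) (3 * R j))) F"
     "A M \<subseteq> (\<Union>i\<in>F. cball (x i) (5 * (3 * R i)))"
    by (rule Vitali_covering_lemma_cballs)
  have fin: "finite F"
    using F(2) K finite_subset by blast
  define V where "V m = E \<inter> cball (x m) (15 * R m) - (\<Union>j\<in>F \<inter> {..<m}. cball (x j) (15 * R j))" for m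
  have V: "V m \<in> sets \<nu>" for m
    unfolding V_def by measurable
  have disj: "disjoint_family_on V F"
    unfolding disjoint_family_on_def
  proof safe
    fix m n y assume "m \<in> F" "n \<in> F" "m \<noteq> n" "y \<in> V m" "y \<in> V n"
    then show "y \<in> {}"
      by (cases m n rule: linorder_cases) (auto simp: V_def)
  qed
  have "A M \<subseteq> (\<Union>m\<in>F. V m)"
  proof
    fix y assume y: "y \<in> A M"
    define m where "m = (LEAST m. m \<in> F \<and> y \<in> cball (x m) (15 * R m))"
    obtain m' where "m' \<in> F" "y \<in> cball (x m') (5 * (3 * R m'))"
      using F(4) y by blast
    then have "\<exists>m. m \<in> F \<and> y \<in> cball (x m) (15 * R m)"
      by auto
    then have "m \<in> F \<and> y \<in> cball (x m) (15 * R m)"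
      unfolding m_def by (rule LeastI_ex)
    moreover have "\<not> (j \<in> F \<and> y \<in> cball (x j) (15 * R j))" if "j < m" for j
      using that unfolding m_def by (rule not_less_Least)
    ultimately show "y \<in> (\<Union>m\<in>F. V m)"
      using y by (auto simp: V_def A_def)
  qed
  then have "measure \<nu> (A M) \<le> measure \<nu> (\<Union>m\<in>F. V m)"
    using V fin by (intro finite_measure_mono sets.finite_UN) auto
  also have "\<dots> = (\<Sum>m\<in>F. measure \<nu> (V m))"
    using V fin disj by (intro finite_measure_finite_Union) auto
  finally have "measure \<nu> E / 2 \<le> (\<Sum>m\<in>F. measure \<nu> (V m))"
    using M by simp
  moreover have "V m \<subseteq> E \<inter> cball (x m) (15 * R m)" for m
    by (auto simp: V_def)
  ultimately show ?thesis
    using fin F(2,3) disj V sets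
    by (intro exI[of _ F] exI[of _ V]) (auto simp: K_def)
qed

section \<open>Content of the rectangles inside a dyadic cube\<close>

lemma dyadic_cube_subset_children:
  "dyadic_cube p k \<subseteq> (\<Union>k'\<in>children k. dyadic_cube (Suc p) k')"
proof
  fix y assume y: "y \<in> dyadic_cube p k"
  define k' where "k' i = (if y $ i \<le> (2 * real (k i) + 1) / 2 ^ Suc p then 2 * k i else 2 * k i + 1)" for i
  have "k' \<in> children k"
    by (auto simp: children_def parent_def k'_def)
  moreover have "y \<in> dyadic_cube (Suc p) k'"
  proof -
    have "real (k' i) / 2 ^ Suc p \<le> y $ i \<and> y $ i \<le> (real (k' i) + 1) / 2 ^ Suc p" for i
    proof -
      have "real (k i) \<le> y $ i * 2 ^ p" "y $ i * 2 ^ p \<le> real (k i) + 1"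
        using y by (auto simp: dyadic_cube_eq pos_divide_le_eq pos_le_divide_eq)
      moreover have "y $ i * 2 ^ Suc p = 2 * (y $ i * 2 ^ p)"
        by simp
      ultimately show ?thesis
        by (simp only: pos_divide_le_eq pos_le_divide_eq zero_less_power zero_less_numeral k'_def)
          (simp split: if_split)
    qed
    then show ?thesis
      by (simp add: dyadic_cube_eq)
  qed
  ultimately show "y \<in> (\<Union>k'\<in>children k. dyadic_cube (Suc p) k')"
    by blast
qed

lemma dist_dyadic_cube_le:
  fixes y z :: "real^'n"
  assumes "y \<in> dyadic_cube p k" "z \<in> dyadic_cube p k"
  shows "dist y z \<le> CARD('n) * (1 / 2) ^ p"
proof -
  have "dist y z \<le> (\<Sum>i\<in>UNIV. \<bar>(y - z) $ i\<bar>)"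
    unfolding dist_norm by (rule norm_le_l1_cart)
  also have "\<dots> \<le> (\<Sum>i\<in>(UNIV :: 'n set). (1 / 2) ^ p)"
  proof (rule sum_mono)
    fix i
    have "y $ i \<le> real (k i) / 2 ^ p + (1 / 2) ^ p" "z $ i \<le> real (k i) / 2 ^ p + (1 / 2) ^ p"
      "real (k i) / 2 ^ p \<le> y $ i" "real (k i) / 2 ^ p \<le> z $ i"
      using assms by (auto simp: dyadic_cube_eq add_divide_distrib power_one_over)
    then show "\<bar>(y - z) $ i\<bar> \<le> (1 / 2) ^ p"
      by (simp add: abs_le_iff)
  qed
  finally show ?thesis
    by simp
qed

lemma measure_core_box: "measure lborel (core_box :: (real^'n) set) = (1 / 2) ^ CARD('n)"
proof -
  have "(core_box :: (real^'n) set) \<noteq> {}"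
  proof -
    have "(\<chi> i. 1 / 2) \<in> (core_box :: (real^'n) set)"
      by (simp add: core_box_def mem_box_cart)
    then show ?thesis
      by blast
  qed
  then show ?thesis
    unfolding core_box_def by (subst content_cbox_cart) auto
qed

lemma rect_map_vimage_sets:
  "D \<in> sets borel \<Longrightarrow> core_box \<inter> rect_map \<tau> x r Q -` D \<in> sets borel"
proof -
  assume "D \<in> sets borel"
  moreover have "rect_map \<tau> x r Q \<in> borel_measurable borel"
    by (intro borel_measurable_continuous_onI continuous_on_rect_map)
  ultimately have "rect_map \<tau> x r Q -` D \<in> sets borel"
    using measurable_sets[of "rect_map \<tau> x r Q" borel borel D] by simp
  then show ?thesis
    by (auto simp: core_box_def)
qed

lemma dyadic_cube_sets [measurable]: "dyadic_cube p k \<in> sets borel"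
  using compact_dyadic_cube by (rule borel_compact)

text \<open>A cube of side \<open>\<rho>\<close> meets at most one ball of radius at least \<open>\<rho>\<close>, by disjointness of the
  tripled balls; the smaller balls that it meets are controlled together by \<open>growth\<close>.\<close>

lemma mass_in_cube_le:
  fixes \<tau> :: "'n::{finite,wellorder} \<Rightarrow> real" and x :: "nat \<Rightarrow> real^'n::_"
    and r :: "nat \<Rightarrow> real" and Q :: "nat \<Rightarrow> real^'n::_^'n::_" and s a a' C1 :: real
    and \<nu> :: "(real^'n::_) measure"
  defines "L \<equiv> real CARD('n)"
  assumes r: "\<And>n. n \<in> F \<Longrightarrow> 0 < r n \<and> r n < 1" and \<tau>: "\<And>i. 1 \<le> \<tau> i" "mono \<tau>"
    and Q: "\<And>n. orthogonal_matrix (Q n)"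
    and s: "0 < s" "s \<le> a'" "a' < a" "s \<le> CARD('n)"
    and bound: "\<And>k. s * \<tau> k \<le> a' + (\<Sum>j\<in>{..k}. \<tau> k - \<tau> j)"
    and "finite_measure \<nu>" and sets: "sets \<nu> = sets borel"
    and \<delta>: "0 < \<delta>" and C1: "0 < C1"
    and growth: "\<And>e \<rho>. e \<in> E \<Longrightarrow> 0 < \<rho> \<Longrightarrow> measure \<nu> (ball e \<rho>) \<le> C1 * (\<rho> / \<delta>) powr a"
    and F: "finite F" "disjoint_family_on V F"
      "pairwise (\<lambda>m n. disjnt (cball (x m) (3 * (L * r m))) (cball (x n) (3 * (L * r n)))) F"
    and V: "\<And>m. m \<in> F \<Longrightarrow> V m \<in> sets borel" "\<And>m. m \<in> F \<Longrightarrow> V m \<subseteq> E \<inter> cball (x m) (15 * (L * r m))"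
    and small: "\<And>n. n \<in> F \<Longrightarrow> r n powr (a - a') \<le> \<delta> powr (a - s)"
    and \<rho>: "(1 / 2) ^ g = \<rho>" "\<rho> \<le> \<delta>"
  shows "(\<Sum>m\<in>F. measure \<nu> (V m) * measure lborel (core_box \<inter> rect_map \<tau> (x m) (r m) (Q m) -` dyadic_cube g l))
    \<le> C1 * ((34 * L) powr a + (31 * L) powr a * (2 * L) ^ CARD('n)) * (\<rho> / \<delta>) powr s"
proof -
  interpret finite_measure \<nu> by fact
  define D where "D = dyadic_cube g l"
  define w where "w m = measure \<nu> (V m)" for m
  define \<mu> where "\<mu> m = measure lborel (core_box \<inter> rect_map \<tau> (x m) (r m) (Q m) -` D)" for m
  define M where "M = {m\<in>F. V m \<noteq> {} \<and> core_box \<inter> rect_map \<tau> (x m) (r m) (Q m) -` D \<noteq> {}}"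
  have L: "1 \<le> L"
    unfolding L_def using zero_less_card_finite[where 'a = 'n] by linarith
  have \<rho>0: "0 < \<rho>"
    using \<rho>(1) by auto
  have distD: "dist z z' \<le> L * \<rho>" if "z \<in> D" "z' \<in> D" for z z'
    using dist_dyadic_cube_le that \<rho>(1) unfolding D_def L_def by blast
  have meets: "\<exists>z\<in>D. dist (x m) z \<le> L * r m" if m: "m \<in> M" for m
  proof -
    obtain y where "y \<in> core_box" "rect_map \<tau> (x m) (r m) (Q m) y \<in> D"
      using m by (auto simp: M_def)
    then show ?thesis
      using rect_map_dist_le[OF Q, of "r m" \<tau> y "x m"] r[of m] \<tau>(1) m core_box_subset
      unfolding L_def M_def by (intro bexI[of _ "rect_map \<tau> (x m) (r m) (Q m) y"]) auto
  qed
  have meas: "core_box \<inter> rect_map \<tau> (x m) (r m) (Q m) -` D \<in> sets borel" for m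
    unfolding D_def by (intro rect_map_vimage_sets dyadic_cube_sets)
  have \<mu>1: "0 \<le> \<mu> m" "\<mu> m \<le> 1" for m
  proof -
    have "\<mu> m \<le> measure lborel (core_box :: (real^'n::_) set)"
      unfolding \<mu>_def using meas by (intro measure_mono_fmeasurable) (auto simp: core_box_def)
    also have "\<dots> \<le> 1"
      by (simp add: measure_core_box power_le_one)
    finally show "\<mu> m \<le> 1" .
  qed (simp add: \<mu>_def)
  have w0: "0 \<le> w m" for m
    by (simp add: w_def)
  have finM: "finite M"
    using F(1) by (simp add: M_def)
  have "(\<Sum>m\<in>F. w m * \<mu> m) = (\<Sum>m\<in>M. w m * \<mu> m)"
    using F(1) by (intro sum.mono_neutral_right) (auto simp: M_def w_def \<mu>_def)
  also have "M = {m\<in>M. r m < \<rho>} \<union> {m\<in>M. \<rho> \<le> r m}"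
    by auto
  also have "(\<Sum>m\<in>{m\<in>M. r m < \<rho>} \<union> {m\<in>M. \<rho> \<le> r m}. w m * \<mu> m) =
      (\<Sum>m\<in>{m\<in>M. r m < \<rho>}. w m * \<mu> m) + (\<Sum>m\<in>{m\<in>M. \<rho> \<le> r m}. w m * \<mu> m)"
    using finM by (intro sum.union_disjoint) auto
  also have "\<dots> \<le> C1 * (34 * L) powr a * (\<rho> / \<delta>) powr s +
      C1 * (31 * L) powr a * (2 * L) ^ CARD('n) * (\<rho> / \<delta>) powr s"
  proof (rule add_mono)
    show "(\<Sum>m\<in>{m\<in>M. r m < \<rho>}. w m * \<mu> m) \<le> C1 * (34 * L) powr a * (\<rho> / \<delta>) powr s" (is "sum _ ?S \<le> ?B")
    proof (cases "?S = {}")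
      case True
      then show ?thesis
        using C1 by (simp only: True) simp
    next
      case False
      then obtain m where m: "m \<in> M" "r m < \<rho>"
        by blast
      obtain e where e: "e \<in> V m"
        using m by (auto simp: M_def)
      have eE: "e \<in> E" and e_dist: "dist (x m) e \<le> 15 * (L * r m)"
        using e V(2)[of m] m by (auto simp: M_def)
      \<comment> \<open>Both cores reach \<open>D\<close>, of diameter at most
        \<open>L * \<rho>\<close>, and both radii are below \<rho>: the distances add up to 15 + 1 +
        1 + 1 + 15 = 33 times \<open>L * \<rho>\<close>, rounded up to 34 for the open ball.\<close>
      have sub: "(\<Union>n\<in>?S. V n) \<subseteq> ball e (34 * L * \<rho>)"
      proof safe
        fix n y assume n: "n \<in> M" "r n < \<rho>" "y \<in> V n"
        obtain z where z: "z \<in> D" "dist (x m) z \<le> L * r m"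
          using meets m by blast
        obtain z' where z': "z' \<in> D" "dist (x n) z' \<le> L * r n"
          using meets n by blast
        have "dist (x n) y \<le> 15 * (L * r n)"
          using n V(2)[of n] by (auto simp: M_def)
        then have "dist e y \<le> 15 * (L * r m) + L * r m + L * \<rho> + L * r n + 15 * (L * r n)"
          using e_dist z z' distD[OF z(1) z'(1)]
            dist_triangle[of e y "x m"] dist_triangle[of "x m" y z] dist_triangle[of z y z']
            dist_triangle[of z' y "x n"] by (simp add: dist_commute)
        moreover have "L * r m < L * \<rho>" "L * r n < L * \<rho>" "0 < L * \<rho>"
          using m n L \<rho>0 by auto
        ultimately show "y \<in> ball e (34 * L * \<rho>)"
          by simp
      qed
      have "sum (\<lambda>m. w m * \<mu> m) ?S \<le> sum w ?S"
        using w0 \<mu>1 by (intro sum_mono) (simp add: mult_left_le)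
      also have "\<dots> = measure \<nu> (\<Union>n\<in>?S. V n)"
        unfolding w_def using F(1) V(1) sets F(2)
        by (intro finite_measure_finite_Union[symmetric]) (auto simp: M_def disjoint_family_on_def)
      also have "\<dots> \<le> measure \<nu> (ball e (34 * L * \<rho>))"
        using sub sets by (intro finite_measure_mono) auto
      also have "\<dots> \<le> C1 * (34 * L * \<rho> / \<delta>) powr a"
        using growth[OF eE] L \<rho>0 by simp
      also have "\<dots> = C1 * (34 * L) powr a * (\<rho> / \<delta>) powr a"
        using L \<rho>0 \<delta> powr_mult[of "34 * L" "\<rho> / \<delta>" a] by simp
      \<comment> \<open>Since \<open>\<rho> \<le> \<delta>\<close>, lowering the exponent from a to
        s only increases the power.\<close>
      also have "\<dots> \<le> C1 * (34 * L) powr a * (\<rho> / \<delta>) powr s"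
        using C1 s \<rho>(2) \<rho>0 \<delta> by (intro mult_left_mono powr_mono') auto
      finally show ?thesis .
    qed
    show "(\<Sum>m\<in>{m\<in>M. \<rho> \<le> r m}. w m * \<mu> m) \<le>
        C1 * (31 * L) powr a * (2 * L) ^ CARD('n) * (\<rho> / \<delta>) powr s" (is "sum _ ?T \<le> ?B")
    proof (cases "?T = {}")
      case True
      then show ?thesis
        using C1 L by (simp only: True) simp
    next
      case False
      then obtain m where m: "m \<in> M" "\<rho> \<le> r m"
        by blast
      have mF: "m \<in> F"
        using m by (simp add: M_def)
      \<comment> \<open>As \<open>D\<close> has diameter at most \<open>L * \<rho>\<close> and
        \<open>\<rho> \<le> r n\<close>, the point of \<open>D\<close> near \<open>x m\<close> is
        within \<open>2 * (L * r n)\<close> of \<open>x n\<close>; so two distinct tripled balls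
        would meet.\<close>
      have "n = m" if n: "n \<in> ?T" for n
      proof (rule ccontr)
        assume "n \<noteq> m"
        then have disj: "disjnt (cball (x m) (3 * (L * r m))) (cball (x n) (3 * (L * r n)))"
          using F(3) m n by (auto simp: pairwise_def M_def)
        obtain z where z: "z \<in> D" "dist (x m) z \<le> L * r m"
          using meets m by blast
        obtain z' where z': "z' \<in> D" "dist (x n) z' \<le> L * r n"
          using meets n by blast
        have "L * \<rho> \<le> L * r n" "0 \<le> L * r n" "0 \<le> L * r m"
          using n m L r[OF mF] \<rho>0 by (auto intro: mult_left_mono)
        then have "dist (x n) z \<le> 3 * (L * r n)" "dist (x m) z \<le> 3 * (L * r m)"
          using z z' distD[OF z'(1) z(1)] dist_triangle[of "x n" z z'] by auto
        then show False
          using disj by (auto simp: disjnt_iff)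
      qed
      then have "?T = {m}"
        using m by blast
      then have "(\<Sum>m\<in>?T. w m * \<mu> m) = w m * \<mu> m"
        by simp
      also have "\<dots> \<le> (C1 * (31 * L * r m / \<delta>) powr a) *
          ((2 * L) ^ CARD('n) * (\<Prod>j\<in>UNIV. min 1 (\<rho> / r m powr \<tau> j)))"
      proof (intro mult_mono)
        obtain e where e: "e \<in> V m"
          using m by (auto simp: M_def)
        have eE: "e \<in> E"
          using e V(2)[OF mF] by auto
        have "V m \<subseteq> ball e (31 * L * r m)"
        proof
          fix y assume "y \<in> V m"
          then have "dist (x m) y \<le> 15 * (L * r m)" "dist (x m) e \<le> 15 * (L * r m)"
            using V(2)[OF mF] e by auto
          moreover have "0 < L * r m"
            using L r[OF mF] by simp
          ultimately show "y \<in> ball e (31 * L * r m)"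
            using dist_triangle[of e y "x m"] by (simp add: dist_commute)
        qed
        then have "w m \<le> measure \<nu> (ball e (31 * L * r m))"
          unfolding w_def using sets by (intro finite_measure_mono) auto
        then show "w m \<le> C1 * (31 * L * r m / \<delta>) powr a"
          using growth[OF eE, of "31 * L * r m"] L r[OF mF] by simp
        show "\<mu> m \<le> (2 * L) ^ CARD('n) * (\<Prod>j\<in>UNIV. min 1 (\<rho> / r m powr \<tau> j))"
          unfolding \<mu>_def using Q r[OF mF] L \<rho>0 distD meas by (intro measure_rect_map_vimage_le) auto
      qed (use C1 \<mu>1 in auto)
      \<comment> \<open>Splitting off \<open>r m powr a'\<close> feeds the product estimate. The
        spare \<open>r m powr (a - a')\<close> is at most \<open>\<delta> powr (a - s)\<close>,
        which turns the factor \<delta>^(-a) into \<delta>^(-s). The 31 exceeds 15 + 15, the reach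
        of a single piece, to fit an open ball.\<close>
      also have "\<dots> = (C1 * (31 * L) powr a * (2 * L) ^ CARD('n)) *
          (r m powr (a - a') * (r m powr a' * (\<Prod>j\<in>UNIV. min 1 (\<rho> / r m powr \<tau> j))) / \<delta> powr a)"
      proof -
        have "(31 * L * r m / \<delta>) powr a = (31 * L) powr a * (r m powr (a - a') * r m powr a') / \<delta> powr a"
          using L r[OF mF] \<delta> by (simp add: powr_divide powr_mult powr_add[symmetric])
        then show ?thesis
          by simp
      qed
      also have "\<dots> \<le> (C1 * (31 * L) powr a * (2 * L) ^ CARD('n)) * (\<delta> powr (a - s) * \<rho> powr s / \<delta> powr a)"
      proof (intro mult_left_mono divide_right_mono mult_mono)
        show "r m powr (a - a') \<le> \<delta> powr (a - s)"
          using small[OF mF] .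
        show "r m powr a' * (\<Prod>j\<in>UNIV. min 1 (\<rho> / r m powr \<tau> j)) \<le> \<rho> powr s"
          using \<tau> s bound r[OF mF] \<rho>0 by (intro powr_mult_prod_min_le) auto
      qed (use C1 L \<rho>0 in \<open>auto intro!: mult_nonneg_nonneg prod_nonneg\<close>)
      also have "\<delta> powr (a - s) * \<rho> powr s / \<delta> powr a = (\<rho> / \<delta>) powr s"
        using \<delta> \<rho>0 by (simp add: powr_diff powr_divide)
      finally show ?thesis .
    qed
  qed
  also have "\<dots> = C1 * ((34 * L) powr a + (31 * L) powr a * (2 * L) ^ CARD('n)) * (\<rho> / \<delta>) powr s"
    by (simp add: algebra_simps)
  finally show ?thesis
    by (simp add: w_def \<mu>_def D_def)
qed

text \<open>The normalized mass \<open>\<nu>'\<close> satisfies the hypotheses of the mass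
  distribution principle. In the constant, \<open>\<kappa> / 2\<close> is the mass kept by the
  selection, \<open>(1 / 2) ^ CARD('n)\<close> the volume of \<open>core_box\<close>, and the
  denominator the mass bound for cubes. None of these mentions p, k, N or \<eta>: the margin and the
  scale of the cube only decide how late the balls are taken.\<close>

lemma content_of_rectangles_in_cube:
  fixes \<tau> :: "'n::{finite,wellorder} \<Rightarrow> real" and x :: "nat \<Rightarrow> real^'n::_"
    and r :: "nat \<Rightarrow> real" and Q :: "nat \<Rightarrow> real^'n::_^'n::_" and s a a' C1 \<kappa> :: real
    and \<nu> :: "(real^'n::_) measure"
  defines "L \<equiv> real CARD('n)"
  assumes r: "\<And>n. 0 < r n" "r \<longlonglongrightarrow> 0" and \<tau>: "\<And>i. 1 \<le> \<tau> i" "mono \<tau>"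
    and Q: "\<And>n. orthogonal_matrix (Q n)"
    and s: "0 < s" "s \<le> a'" "a' < a" "s \<le> CARD('n)"
    and bound: "\<And>k. s * \<tau> k \<le> a' + (\<Sum>j\<in>{..k}. \<tau> k - \<tau> j)"
    and \<nu>: "finite_measure \<nu>" and sets: "sets \<nu> = sets borel"
    and C1: "0 < C1"
    and E: "E \<in> sets borel" and \<eta>: "0 < \<eta>" "\<And>e. e \<in> E \<Longrightarrow> ball e \<eta> \<subseteq> dyadic_cube p k"
    and growth: "\<And>e \<rho>. e \<in> E \<Longrightarrow> 0 < \<rho> \<Longrightarrow> measure \<nu> (ball e \<rho>) \<le> C1 * (\<rho> / (1 / 2) ^ p) powr a"
    and null: "\<And>N. measure \<nu> (E - (\<Union>n\<in>{N..}. cball (x n) (L * r n))) = 0"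
    and \<kappa>: "0 < \<kappa>" "\<kappa> \<le> measure \<nu> E"
  shows "\<exists>i. \<kappa> / 2 * (1 / 2) ^ CARD('n) / (C1 * ((34 * L) powr a + (31 * L) powr a * (2 * L) ^ CARD('n))) *
    (2 powr - s) ^ p \<le>
    cap (2 powr - s) (cubes_in (\<Union>n\<in>{N..}. interior (rectangle \<tau> (x n) (r n) (Q n))) (p + i)) i p k"
proof -
  define G where "G = (\<Union>n\<in>{N..}. interior (rectangle \<tau> (x n) (r n) (Q n)))"
  define \<delta> :: real where "\<delta> = (1 / 2) ^ p"
  define C2 where "C2 = C1 * ((34 * L) powr a + (31 * L) powr a * (2 * L) ^ CARD('n))"
  have L: "1 \<le> L"
    unfolding L_def using zero_less_card_finite[where 'a = 'n] by linarith
  have \<delta>: "0 < \<delta>"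
    by (simp add: \<delta>_def)
  have C2: "0 < C2"
    unfolding C2_def using C1 L by (intro mult_pos_pos add_pos_nonneg) auto
  have scale: "(2 powr - s) ^ g = ((1 / 2) ^ g) powr s" for g
  proof -
    have "(1 / 2) ^ g = (2::real) powr (- real g)"
      by (simp add: powr_minus powr_realpow power_one_over inverse_eq_divide)
    then show ?thesis
      by (simp add: powr_powr powr_power mult.commute)
  qed
  have "\<forall>\<^sub>F n in sequentially. r n < 1 \<and> r n < \<eta> / (2 * L) \<and> r n powr (a - a') \<le> \<delta> powr (a - s)"
  proof (intro eventually_conj)
    show "\<forall>\<^sub>F n in sequentially. r n < 1" "\<forall>\<^sub>F n in sequentially. r n < \<eta> / (2 * L)"
      using r(2) \<eta>(1) L by (auto intro!: order_tendstoD(2))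
    have "(\<lambda>n. r n powr (a - a')) \<longlonglongrightarrow> 0"
      using tendsto_powr2[OF r(2), of "\<lambda>_. a - a'" "a - a'"] r(1) s by (simp add: less_imp_le)
    then have "\<forall>\<^sub>F n in sequentially. r n powr (a - a') < \<delta> powr (a - s)"
      using \<delta> by (intro order_tendstoD(2)) auto
    then show "\<forall>\<^sub>F n in sequentially. r n powr (a - a') \<le> \<delta> powr (a - s)"
      by eventually_elim simp
  qed
  \<comment> \<open>The second bound confines the cores of balls meeting \<open>E\<close> to the
    cube; the third lets the spare exponent absorb the scale \<delta>.\<close>
  then obtain N0 where N0: "\<And>n. N0 \<le> n \<Longrightarrow> r n < 1"
    "\<And>n. N0 \<le> n \<Longrightarrow> r n < \<eta> / (2 * L)" "\<And>n. N0 \<le> n \<Longrightarrow> r n powr (a - a') \<le> \<delta> powr (a - s)"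
    unfolding eventually_sequentially by blast
  have "0 < L * r n" for n
    using L r(1) by simp
  then have "\<exists>F V. finite F \<and> F \<subseteq> {max N N0..} \<and> disjoint_family_on V F \<and>
    (\<forall>m\<in>F. V m \<in> sets borel \<and> V m \<subseteq> E \<inter> cball (x m) (15 * (L * r m)) \<and> cball (x m) (L * r m) \<inter> E \<noteq> {}) \<and>
    pairwise (\<lambda>m n. disjnt (cball (x m) (3 * (L * r m))) (cball (x n) (3 * (L * r n)))) F \<and>
    measure \<nu> E / 2 \<le> (\<Sum>m\<in>F. measure \<nu> (V m))"
    using \<nu> sets E null \<kappa> by (intro ex_disjoint_family) auto
  then obtain F V where F: "finite F" "F \<subseteq> {max N N0..}" "disjoint_family_on V F"
    "pairwise (\<lambda>m n. disjnt (cball (x m) (3 * (L * r m))) (cball (x n) (3 * (L * r n)))) F"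
    and V: "\<And>m. m \<in> F \<Longrightarrow> V m \<in> sets borel" "\<And>m. m \<in> F \<Longrightarrow> V m \<subseteq> E \<inter> cball (x m) (15 * (L * r m))"
    and near: "\<And>m. m \<in> F \<Longrightarrow> cball (x m) (L * r m) \<inter> E \<noteq> {}"
    and total: "measure \<nu> E / 2 \<le> (\<Sum>m\<in>F. measure \<nu> (V m))"
    by blast
  have FN: "N \<le> m" "r m < 1" "r m < \<eta> / (2 * L)" "r m powr (a - a') \<le> \<delta> powr (a - s)" if "m \<in> F" for m
    using F(2) N0 that by force+
  define \<mu> where "\<mu> g l m = measure lborel (core_box \<inter> rect_map \<tau> (x m) (r m) (Q m) -` dyadic_cube g l)" for g l m
  define mass where "mass g l = (\<Sum>m\<in>F. measure \<nu> (V m) * \<mu> g l m)" for g l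
  \<comment> \<open>Normalized so that the bound \<open>C2 * (\<rho> / \<delta>) powr s\<close> on
    \<open>mass\<close> becomes \<rho>^s.\<close>
  define \<nu>' where "\<nu>' g l = \<delta> powr s / C2 * mass g l" for g l
  have core_dist: "dist (x m) z \<le> L * r m" if "m \<in> F" "z \<in> rect_map \<tau> (x m) (r m) (Q m) ` core_box" for m z
    using that rect_map_dist_le[OF Q r(1), of m \<tau>] FN(2)[of m] \<tau>(1) core_box_subset unfolding L_def by fastforce
  \<comment> \<open>The cores form a compact subset of the open set \<open>G\<close>, so from some
    depth on every cube that meets a core lies inside \<open>G\<close>; this provides the finite
    depth i.\<close>
  define Z where "Z = (\<Union>m\<in>F. rect_map \<tau> (x m) (r m) (Q m) ` core_box)"
  have "compact Z"
    unfolding Z_def using F(1) by (intro compact_UN compact_core) auto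
  moreover have "open G"
    by (auto simp: G_def)
  moreover have "Z \<subseteq> G"
    unfolding Z_def G_def using core_subset_interior[OF r(1) Q] FN(1) by fastforce
  ultimately obtain \<epsilon> where \<epsilon>: "0 < \<epsilon>" "(\<Union>z\<in>Z. ball z \<epsilon>) \<subseteq> G"
    by (rule compact_subset_open_imp_ball_epsilon_subset)
  obtain i where i: "(1 / 2) ^ i < \<epsilon> / L"
    using real_arch_pow_inv[of "\<epsilon> / L" "1 / 2"] \<epsilon>(1) L by auto
  have leaf: "\<nu>' (p + i) l \<le> 0" if l: "l \<notin> cubes_in G (p + i)" for l
  proof -
    have "core_box \<inter> rect_map \<tau> (x m) (r m) (Q m) -` dyadic_cube (p + i) l = {}" if m: "m \<in> F" for m
    proof (rule ccontr)
      assume "\<not> ?thesis"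
      then obtain z where z: "z \<in> Z" "z \<in> dyadic_cube (p + i) l"
        using m by (auto simp: Z_def)
      have "L * (1 / 2) ^ (p + i) \<le> L * (1 / 2) ^ i"
        using L by (intro mult_left_mono power_decreasing) auto
      also have "\<dots> < \<epsilon>"
        using i L by (simp add: field_simps)
      finally have "dyadic_cube (p + i) l \<subseteq> ball z \<epsilon>"
        using dist_dyadic_cube_le[OF z(2)] unfolding L_def by fastforce
      then show False
        using l z(1) \<epsilon>(2) by (auto simp: cubes_in_def)
    qed
    then show ?thesis
      by (simp add: \<nu>'_def mass_def \<mu>_def)
  qed
  have "\<nu>' p k \<le> cap (2 powr - s) (cubes_in G (p + i)) i p k"
  proof (rule mass_le_cap)
    fix g and l :: "'n \<Rightarrow> nat"
    have "\<mu> g l m \<le> (\<Sum>l'\<in>children l. \<mu> (Suc g) l' m)" for m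
    proof -
      have "\<mu> g l m \<le> measure lborel (\<Union>l'\<in>children l. core_box \<inter> rect_map \<tau> (x m) (r m) (Q m) -` dyadic_cube (Suc g) l')"
        unfolding \<mu>_def
      proof (intro measure_mono_fmeasurable)
        show "core_box \<inter> rect_map \<tau> (x m) (r m) (Q m) -` dyadic_cube g l \<subseteq>
            (\<Union>l'\<in>children l. core_box \<inter> rect_map \<tau> (x m) (r m) (Q m) -` dyadic_cube (Suc g) l')"
          using dyadic_cube_subset_children[of g l] by blast
        have "(\<Union>l'\<in>children l. core_box \<inter> rect_map \<tau> (x m) (r m) (Q m) -` dyadic_cube (Suc g) l') \<in> sets lborel"
          by (intro sets.finite_UN) (simp_all add: rect_map_vimage_sets dyadic_cube_sets)
        moreover have "core_box \<in> fmeasurable lborel"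
          by (simp add: core_box_def)
        ultimately show "(\<Union>l'\<in>children l. core_box \<inter> rect_map \<tau> (x m) (r m) (Q m) -` dyadic_cube (Suc g) l') \<in> fmeasurable lborel"
          by (elim fmeasurableI2[rotated 2]) auto
      qed (auto intro!: rect_map_vimage_sets dyadic_cube_sets)
      also have "\<dots> \<le> (\<Sum>l'\<in>children l. \<mu> (Suc g) l' m)"
        unfolding \<mu>_def
        by (intro measure_UNION_le) (auto intro!: rect_map_vimage_sets dyadic_cube_sets)
      finally show ?thesis .
    qed
    then have "mass g l \<le> (\<Sum>m\<in>F. measure \<nu> (V m) * (\<Sum>l'\<in>children l. \<mu> (Suc g) l' m))"
      unfolding mass_def by (intro sum_mono mult_left_mono) auto
    also have "\<dots> = (\<Sum>l'\<in>children l. mass (Suc g) l')"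
      unfolding mass_def sum_distrib_left by (rule sum.swap)
    finally have "\<delta> powr s / C2 * mass g l \<le> \<delta> powr s / C2 * (\<Sum>l'\<in>children l. mass (Suc g) l')"
      using C2 by (intro mult_left_mono) auto
    then show "\<nu>' g l \<le> (\<Sum>l'\<in>children l. \<nu>' (Suc g) l')"
      by (simp add: \<nu>'_def sum_distrib_left)
  next
    fix g and l :: "'n \<Rightarrow> nat" assume "p \<le> g"
    then have le: "(1 / 2) ^ g \<le> \<delta>"
      unfolding \<delta>_def by (intro power_decreasing) auto
    have "mass g l \<le> C2 * ((1 / 2) ^ g / \<delta>) powr s"
      unfolding mass_def \<mu>_def C2_def L_def
      using r(1) FN \<tau> Q s bound \<nu> sets \<delta> C1 growth F V le
      by (intro mass_in_cube_le[where a' = a' and E = E]) (auto simp: L_def \<delta>_def)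
    then have "\<delta> powr s / C2 * mass g l \<le> \<delta> powr s / C2 * (C2 * ((1 / 2) ^ g / \<delta>) powr s)"
      using C2 by (intro mult_left_mono) auto
    also have "\<dots> = (2 powr - s) ^ g"
      using C2 \<delta> by (simp add: scale powr_divide)
    finally show "\<nu>' g l \<le> (2 powr - s) ^ g"
      by (simp add: \<nu>'_def)
  qed (use leaf in auto)
  moreover have "\<kappa> / 2 * (1 / 2) ^ CARD('n) / C2 * (2 powr - s) ^ p \<le> \<nu>' p k"
  proof -
    \<comment> \<open>Each selected core lies within \<open>2 * L * r m\<close> of a point of
      \<open>E\<close>, hence inside the root cube: no mass is lost at the root.\<close>
    have "\<mu> p k m = (1 / 2) ^ CARD('n)" if m: "m \<in> F" for m
    proof -
      have "rect_map \<tau> (x m) (r m) (Q m) y \<in> dyadic_cube p k" if y: "y \<in> core_box" for y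
      proof -
        obtain e where e: "e \<in> E" "dist (x m) e \<le> L * r m"
          using near[OF m] by auto
        have "dist e (rect_map \<tau> (x m) (r m) (Q m) y) \<le> L * r m + L * r m"
          using e(2) core_dist[OF m imageI[OF y]] dist_triangle[of e "rect_map \<tau> (x m) (r m) (Q m) y" "x m"]
          by (simp add: dist_commute)
        also have "\<dots> < \<eta>"
          using FN(3)[OF m] L by (simp add: field_simps)
        finally show ?thesis
          using \<eta>(2)[OF e(1)] by auto
      qed
      then have "core_box \<inter> rect_map \<tau> (x m) (r m) (Q m) -` dyadic_cube p k = core_box"
        by blast
      then show ?thesis
        by (simp add: \<mu>_def measure_core_box)
    qed
    then have "mass p k = (\<Sum>m\<in>F. measure \<nu> (V m)) * (1 / 2) ^ CARD('n)"
      by (simp add: mass_def sum_distrib_right)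
    moreover have "\<kappa> / 2 \<le> (\<Sum>m\<in>F. measure \<nu> (V m))"
      using total \<kappa>(2) by linarith
    ultimately have "\<kappa> / 2 * (1 / 2) ^ CARD('n) \<le> mass p k"
      by (simp add: mult_right_mono)
    then have "\<delta> powr s / C2 * (\<kappa> / 2 * (1 / 2) ^ CARD('n)) \<le> \<nu>' p k"
      unfolding \<nu>'_def using C2 by (intro mult_left_mono) auto
    then show ?thesis
      by (simp add: scale \<delta>_def mult_ac)
  qed
  ultimately show ?thesis
    unfolding G_def C2_def by (intro exI[of _ i]) linarith
qed

section \<open>Frostman behaviour of the measure in dyadic cubes\<close>

lemma cube_prob_space_sets:
  assumes "cube_prob \<mu>"
  shows "prob_space \<mu>" "sets \<mu> = sets borel" "space \<mu> = UNIV"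
  using assms sets_eq_imp_space_eq[of \<mu> borel] by (auto simp: cube_prob_def)

section \<open>Sup-norm balls, Euclidean balls and the local dimension\<close>

lemma closed_inf_cball: "closed (inf_cball x r)"
proof -
  have "continuous_on UNIV (\<lambda>y. infnorm (y - x))"
    by (intro continuous_intros)
  then show ?thesis
    unfolding inf_cball_def by (intro closed_Collect_le continuous_on_const)
qed

lemma ball_subset_inf_cball: "ball x r \<subseteq> inf_cball x r"
proof
  fix y assume "y \<in> ball x r"
  then have "infnorm (y - x) \<le> r"
    using infnorm_le_norm[of "y - x"] by (simp add: dist_norm norm_minus_commute)
  then show "y \<in> inf_cball x r"
    by (simp add: inf_cball_def)
qed

lemma inf_cball_subset_cball:
  fixes x :: "real^'n" and r :: real
  shows "inf_cball x r \<subseteq> cball x (CARD('n) * r)"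
proof
  fix y assume y: "y \<in> inf_cball x r"
  have "norm (y - x) \<le> (\<Sum>i\<in>UNIV. \<bar>(y - x) $ i\<bar>)"
    by (rule norm_le_l1_cart)
  also have "\<dots> \<le> (\<Sum>i\<in>(UNIV :: 'n set). r)"
    using y component_le_infnorm_cart[of "y - x"] unfolding inf_cball_def
    by (intro sum_mono) (auto intro: order_trans)
  finally show "y \<in> cball x (CARD('n) * r)"
    by (simp add: dist_norm norm_minus_commute)
qed

lemma lower_local_dim_ball:
  assumes "prob_space \<mu>" "sets \<mu> = sets borel" "ereal a < lower_local_dim \<mu> y"
  shows "\<exists>b>0. \<forall>\<rho>. 0 < \<rho> \<and> \<rho> < b \<longrightarrow> measure \<mu> (ball y \<rho>) \<le> \<rho> powr a"
proof -
  interpret prob_space \<mu> by fact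
  have "eventually (\<lambda>\<rho>. ereal a < ereal (ln (measure \<mu> (inf_cball y \<rho>)) / ln \<rho>)) (at_right 0)"
    using assms(3) unfolding lower_local_dim_def by (rule less_LiminfD)
  then obtain b where b: "0 < b" "\<And>\<rho>. 0 < \<rho> \<Longrightarrow> \<rho> < b \<Longrightarrow> a < ln (measure \<mu> (inf_cball y \<rho>)) / ln \<rho>"
    by (auto simp: eventually_at_right_field)
  have "measure \<mu> (ball y \<rho>) \<le> \<rho> powr a" if \<rho>: "0 < \<rho>" "\<rho> < min b 1" for \<rho>
  proof -
    have "measure \<mu> (ball y \<rho>) \<le> measure \<mu> (inf_cball y \<rho>)"
      using ball_subset_inf_cball assms(2) borel_closed[OF closed_inf_cball] by (intro finite_measure_mono) auto
    also have "\<dots> \<le> \<rho> powr a"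
    \<comment> \<open>Zero mass is treated apart: there \<open>ln 0 = 0\<close> makes the quotient
      of logarithms meaningless, but the bound is trivial.\<close>
    proof (cases "measure \<mu> (inf_cball y \<rho>) = 0")
      case False
      then have pos: "0 < measure \<mu> (inf_cball y \<rho>)"
        by (simp add: zero_less_measure_iff)
      have "ln \<rho> < 0"
        using \<rho> by simp
      then have "ln (measure \<mu> (inf_cball y \<rho>)) < a * ln \<rho>"
        using b(2)[of \<rho>] \<rho> by (simp add: neg_less_divide_eq)
      then have "exp (ln (measure \<mu> (inf_cball y \<rho>))) < exp (a * ln \<rho>)"
        by simp
      then show ?thesis
        using pos \<rho> by (simp add: powr_def)
    qed simp
    finally show ?thesis .
  qed
  then show ?thesis
    using b(1) by (intro exI[of _ "min b 1"]) auto
qed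

text \<open>Centers can be moved at the price of a slightly larger radius:
  \<open>ball y \<rho>\<close> lies in \<open>ball (X n) \<rho>'\<close> for \<open>X n\<close>
  close to y, and then \<rho>' decreases to \<rho>. Closedness settles the measurability of the sets
  on which the Frostman bound is uniform.\<close>

lemma closed_ball_growth:
  fixes \<mu> :: "'a::euclidean_space measure"
  assumes "finite_measure \<mu>" "sets \<mu> = sets borel"
  shows "closed {y. \<forall>\<rho>. 0 < \<rho> \<and> \<rho> < b \<longrightarrow> measure \<mu> (ball y \<rho>) \<le> \<rho> powr a}"
  unfolding closed_sequential_limits
proof safe
  interpret finite_measure \<mu> by fact
  fix X y \<rho> assume X: "\<forall>n. X n \<in> {y. \<forall>\<rho>. 0 < \<rho> \<and> \<rho> < b \<longrightarrow> measure \<mu> (ball y \<rho>) \<le> \<rho> powr a}"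
    and lim: "X \<longlonglongrightarrow> y" and \<rho>: "0 < \<rho>" "\<rho> < b"
  have "measure \<mu> (ball y \<rho>) \<le> \<rho>' powr a" if \<rho>': "\<rho> < \<rho>'" "\<rho>' < b" for \<rho>'
  proof -
    obtain n where n: "dist (X n) y < \<rho>' - \<rho>"
      using metric_LIMSEQ_D[OF lim, of "\<rho>' - \<rho>"] \<rho>' by auto
    have "ball y \<rho> \<subseteq> ball (X n) \<rho>'"
    proof
      fix z assume "z \<in> ball y \<rho>"
      then show "z \<in> ball (X n) \<rho>'"
        using n dist_triangle[of "X n" z y] by simp
    qed
    then have "measure \<mu> (ball y \<rho>) \<le> measure \<mu> (ball (X n) \<rho>')"
      using assms(2) by (intro finite_measure_mono) auto
    also have "\<dots> \<le> \<rho>' powr a"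
      using X \<rho> \<rho>' by auto
    finally show ?thesis .
  qed
  then have "\<forall>\<^sub>F \<rho>' in at_right \<rho>. measure \<mu> (ball y \<rho>) \<le> \<rho>' powr a"
    unfolding eventually_at_right_field using \<rho> by blast
  moreover have "((\<lambda>\<rho>'. \<rho>' powr a) \<longlongrightarrow> \<rho> powr a) (at_right \<rho>)"
    using \<rho> by (intro tendsto_intros) auto
  ultimately show "measure \<mu> (ball y \<rho>) \<le> \<rho> powr a"
    by (intro tendsto_lowerbound) auto
qed

text \<open>Almost every point of the open cube lies in one of countably many closed sets, given by
  a margin \<open>e m\<close> and a radius bound \<open>e n\<close>. The open cube has positive
  mass, since its center is in the support, so one of these sets has positive mass too.\<close>

lemma ex_frostman_set:
  fixes \<mu> :: "(real^'n) measure"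
  assumes \<mu>: "cube_prob \<mu>" "topological_support \<mu> = cbox 0 1" and a: "ereal a < lower_hausdorff_dim \<mu>"
  shows "\<exists>E \<eta> b. closed E \<and> 0 < \<eta> \<and> (\<forall>y\<in>E. \<forall>i. \<eta> \<le> y $ i \<and> y $ i \<le> 1 - \<eta>) \<and> 0 < b \<and>
    (\<forall>y\<in>E. \<forall>\<rho>. 0 < \<rho> \<and> \<rho> < b \<longrightarrow> measure \<mu> (ball y \<rho>) \<le> \<rho> powr a) \<and> 0 < measure \<mu> E"
proof -
  note basic = cube_prob_space_sets[OF \<mu>(1)]
  interpret prob_space \<mu> by (rule basic)
  define e where "e n = 1 / (real n + 1)" for n
  have e: "0 < e n" for n
    by (simp add: e_def)
  have ex_e: "\<exists>n. e n < t" if "0 < t" for t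
    using reals_Archimedean[OF that] by (auto simp: e_def inverse_eq_divide add.commute)
  define A where "A m = {y :: real^'n. \<forall>i. e m \<le> y $ i \<and> y $ i \<le> 1 - e m}" for m
  define B where "B n = {y. \<forall>\<rho>. 0 < \<rho> \<and> \<rho> < e n \<longrightarrow> measure \<mu> (ball y \<rho>) \<le> \<rho> powr a}" for n
  have A_closed: "closed (A m)" for m
  proof -
    have "A m = cbox (\<chi> i. e m) (\<chi> i. 1 - e m)"
      by (auto simp: A_def mem_box_cart)
    then show ?thesis
      using closed_cbox by metis
  qed
  have closed: "closed (A m \<inter> B n)" for m n
    unfolding B_def using A_closed basic finite_measure_axioms by (intro closed_Int closed_ball_growth) auto
  obtain c where c: "AE y in \<mu>. c \<le> lower_local_dim \<mu> y" "ereal a < c"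
    using a by (auto simp: lower_hausdorff_dim_def essential_inf_def less_Sup_iff)
  have "AE y in \<mu>. y \<in> box 0 1 \<longrightarrow> y \<in> (\<Union>m. \<Union>n. A m \<inter> B n)"
    using c(1)
  proof eventually_elim
    case (elim y)
    show ?case
    proof
      assume y: "y \<in> box 0 1"
      define t where "t = Min (range (\<lambda>i. min (y $ i) (1 - y $ i)))"
      have "0 < t"
        using y by (auto simp: t_def mem_box_cart)
      then obtain m where m: "e m < t"
        using ex_e by blast
      have "e m \<le> y $ i \<and> y $ i \<le> 1 - e m" for i
      proof -
        have "t \<le> min (y $ i) (1 - y $ i)"
          unfolding t_def by (intro Min_le) auto
        then show ?thesis
          using m by auto
      qed
      then have "y \<in> A m"
        by (simp add: A_def)
      moreover have "ereal a < lower_local_dim \<mu> y"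
        using c(2) elim by (rule less_le_trans)
      then obtain b where b: "0 < b" "\<And>\<rho>. 0 < \<rho> \<Longrightarrow> \<rho> < b \<Longrightarrow> measure \<mu> (ball y \<rho>) \<le> \<rho> powr a"
        using lower_local_dim_ball[OF basic(1,2)] by blast
      obtain n where "e n < b"
        using ex_e b(1) by blast
      then have "y \<in> B n"
        using b(2) by (auto simp: B_def)
      ultimately show "y \<in> (\<Union>m. \<Union>n. A m \<inter> B n)"
        by blast
    qed
  qed
  have "\<exists>m n. measure \<mu> (A m \<inter> B n) \<noteq> 0"
  proof (rule ccontr)
    assume "\<not> ?thesis"
    then have "AE y in \<mu>. y \<notin> A m \<inter> B n" for m n
      using closed basic(2) by (subst AE_iff_measurable[of "A m \<inter> B n"])
        (auto simp: emeasure_eq_measure basic)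
    then have "AE y in \<mu>. \<forall>m n. y \<notin> A m \<inter> B n"
      unfolding AE_all_countable by blast
    with \<open>AE y in \<mu>. y \<in> box 0 1 \<longrightarrow> y \<in> (\<Union>m. \<Union>n. A m \<inter> B n)\<close>
    have "AE y in \<mu>. y \<notin> box 0 1"
      by eventually_elim blast
    then have "emeasure \<mu> (box 0 1) = 0"
      using basic by (subst (asm) AE_iff_measurable[of "box 0 1"]) auto
    moreover have "(\<chi> i. 1 / 2) \<in> topological_support \<mu>"
      unfolding \<mu>(2) by (simp add: mem_box_cart)
    moreover have "(\<chi> i. 1 / 2) \<in> box 0 (1 :: real^'n)"
      by (simp add: mem_box_cart)
    ultimately show False
      by (auto simp: topological_support_def)
  qed
  then obtain m n where mn: "0 < measure \<mu> (A m \<inter> B n)"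
    by (auto simp: zero_less_measure_iff)
  then show ?thesis
    using closed e by (intro exI[of _ "A m \<inter> B n"] exI[of _ "e m"] exI[of _ "e n"]) (auto simp: A_def B_def)
qed

lemma cbox_subset_dyadic_cubes: "cbox 0 (1 :: real^'n) \<subseteq> (\<Union>k\<in>indices p. dyadic_cube p k)"
proof (induction p)
  case 0
  show ?case
    by (auto simp: indices_def dyadic_cube_eq mem_box_cart)
next
  case (Suc p)
  then show ?case
    using dyadic_cube_subset_children children_indices by (fastforce dest!: subsetD)
qed

text \<open>Each of the (2^p)^d cubes of generation p holds at most a constant times 2^(-p a) of the
  mass of \<open>E\<close>, so a > d would force \<open>E\<close> to be null. This is what yields
  the strict inequality s < d behind the self-improvement of contents.\<close>

lemma frostman_exponent_le:
  fixes \<mu> :: "(real^'n) measure"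
  assumes "finite_measure \<mu>" "sets \<mu> = sets borel" and E: "closed E" "E \<subseteq> cbox 0 1" "0 < measure \<mu> E"
    and b: "0 < b" "\<And>y \<rho>. y \<in> E \<Longrightarrow> 0 < \<rho> \<Longrightarrow> \<rho> < b \<Longrightarrow> measure \<mu> (ball y \<rho>) \<le> \<rho> powr a"
  shows "a \<le> CARD('n)"
proof (rule ccontr)
  interpret finite_measure \<mu> by fact
  assume "\<not> a \<le> CARD('n)"
  then have a: "CARD('n) - a < 0"
    by simp
  define L where "L = real CARD('n)"
  have L: "1 \<le> L"
    unfolding L_def using zero_less_card_finite[where 'a = 'n] by linarith
  have le: "measure \<mu> E \<le> (2 * L) powr a * (2 powr (CARD('n) - a)) ^ p" if p: "(1 / 2) ^ p < b / (2 * L)" for p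
  proof -
    \<comment> \<open>Twice the bound for the diameter of a cube, so that a cube fits into an open
      ball around any of its points.\<close>
    define \<rho> where "\<rho> = 2 * L * (1 / 2) ^ p"
    have \<rho>: "0 < \<rho>" "\<rho> < b"
      using p L by (auto simp: \<rho>_def field_simps)
    have "measure \<mu> (E \<inter> dyadic_cube p k) \<le> \<rho> powr a" for k
    proof (cases "E \<inter> dyadic_cube p k = {}")
      case False
      then obtain y where y: "y \<in> E" "y \<in> dyadic_cube p k"
        by blast
      have "L * (1 / 2) ^ p < \<rho>"
        using L by (simp add: \<rho>_def)
      then have "E \<inter> dyadic_cube p k \<subseteq> ball y \<rho>"
        using dist_dyadic_cube_le[OF y(2)] by (fastforce simp: L_def)
      then have "measure \<mu> (E \<inter> dyadic_cube p k) \<le> measure \<mu> (ball y \<rho>)"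
        using assms(2) by (intro finite_measure_mono) auto
      also have "\<dots> \<le> \<rho> powr a"
        using b(2)[OF y(1)] \<rho> by blast
      finally show ?thesis .
    qed simp
    then have "(\<Sum>k\<in>indices p. measure \<mu> (E \<inter> dyadic_cube p k)) \<le> (2 ^ p) ^ CARD('n) * \<rho> powr a"
      using sum_bounded_above[of "indices p" "\<lambda>k. measure \<mu> (E \<inter> dyadic_cube p k)" "\<rho> powr a"]
      by (simp add: card_indices)
    moreover have "measure \<mu> E \<le> (\<Sum>k\<in>indices p. measure \<mu> (E \<inter> dyadic_cube p k))"
    proof -
      have "E = (\<Union>k\<in>indices p. E \<inter> dyadic_cube p k)"
        using E(2) cbox_subset_dyadic_cubes[of p] by blast
      then have "measure \<mu> E = measure \<mu> (\<Union>k\<in>indices p. E \<inter> dyadic_cube p k)"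
        by simp
      also have "\<dots> \<le> (\<Sum>k\<in>indices p. measure \<mu> (E \<inter> dyadic_cube p k))"
        using E(1) assms(2) dyadic_cube_sets by (intro measure_UNION_le) auto
      finally show ?thesis .
    qed
    moreover have "(2 ^ p) ^ CARD('n) * \<rho> powr a = (2 * L) powr a * (2 powr (CARD('n) - a)) ^ p"
    proof -
      have "\<rho> powr a = (2 * L) powr a * ((1 / 2) ^ p) powr a"
        using L by (simp add: \<rho>_def powr_mult)
      moreover have "((1 / 2) ^ p) powr a = (2::real) powr (- a * real p)"
      proof -
        have "(1 / 2) ^ p = (2::real) powr (- real p)"
          by (simp add: powr_minus powr_realpow power_one_over inverse_eq_divide)
        then show ?thesis
          by (simp add: powr_powr mult.commute)
      qed
      moreover have "((2::real) ^ p) ^ CARD('n) = 2 powr (CARD('n) * real p)"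
        by (metis mult.commute of_nat_mult powr_realpow power_mult zero_less_numeral)
      ultimately show ?thesis
        by (simp add: powr_power powr_add[symmetric] algebra_simps)
    qed
    ultimately show ?thesis
      by linarith
  qed
  have "(\<lambda>p. (2 * L) powr a * (2 powr (CARD('n) - a)) ^ p) \<longlonglongrightarrow> (2 * L) powr a * 0"
    using a powr_less_cancel_iff[of 2 "CARD('n) - a" 0] by (intro tendsto_mult_left LIMSEQ_power_zero) auto
  then have "\<forall>\<^sub>F p in sequentially. (2 * L) powr a * (2 powr (CARD('n) - a)) ^ p < measure \<mu> E"
    using E(3) by (intro order_tendstoD(2)) auto
  moreover have "\<forall>\<^sub>F p in sequentially. (1 / 2 :: real) ^ p < b / (2 * L)"
    using b(1) L by (intro order_tendstoD(2)[OF LIMSEQ_power_zero]) auto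
  ultimately have "\<forall>\<^sub>F p in sequentially. False"
    by eventually_elim (use le not_le in blast)
  then show False
    by simp
qed

section \<open>Charts of dyadic cubes and the quasi-Bernoulli condition\<close>

lemma dyadic_chart_component: "dyadic_chart p k y $ i = 2 ^ p * y $ i - real (k i)"
  by (simp add: dyadic_chart_def dyadic_corner_def right_diff_distrib)

lemma dyadic_chart_mem: "dyadic_chart p k y \<in> cbox 0 1 \<longleftrightarrow> y \<in> dyadic_cube p k"
  by (simp add: mem_box_cart dyadic_chart_component dyadic_cube_eq field_simps)

lemma dist_dyadic_chart: "dist (dyadic_chart p k y) (dyadic_chart p k z) = 2 ^ p * dist y z"
  by (simp add: dyadic_chart_def dist_norm scaleR_diff_right[symmetric])

lemma dyadic_chart_measurable [measurable]: "dyadic_chart p k \<in> borel_measurable borel"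
  unfolding dyadic_chart_def by measurable

lemma emeasure_dyadic_cube_pos:
  fixes \<mu> :: "(real^'n) measure"
  assumes "topological_support \<mu> = cbox 0 1" "sets \<mu> = sets borel" "k \<in> indices p"
  shows "0 < emeasure \<mu> (dyadic_cube p k)"
proof -
  define c :: "real^'n" where "c = (\<chi> i. (real (k i) + 1 / 2) / 2 ^ p)"
  define U where "U = box (dyadic_corner p k) (dyadic_corner p (\<lambda>i. k i + 1) :: real^'n)"
  have "c \<in> cbox 0 1"
  proof -
    have "real (k i) + 1 / 2 \<le> 2 ^ p" for i
    proof -
      have "k i + 1 \<le> 2 ^ p"
        using assms(3) by (auto simp: indices_def Suc_le_eq)
      then have "real (k i + 1) \<le> real (2 ^ p)"
        by (rule of_nat_mono)
      then show ?thesis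
        by simp
    qed
    then show ?thesis
      by (simp add: c_def mem_box_cart pos_divide_le_eq)
  qed
  moreover have "c \<in> U" "open U"
    by (auto simp: c_def U_def mem_box_cart dyadic_corner_def divide_strict_right_mono)
  ultimately have "0 < emeasure \<mu> U"
    using assms(1) by (auto simp: topological_support_def)
  also have "\<dots> \<le> emeasure \<mu> (dyadic_cube p k)"
    unfolding U_def dyadic_cube_def using assms(2) by (intro emeasure_mono box_subset_cbox) auto
  finally show ?thesis .
qed

text \<open>Full support makes every dyadic cube of the unit cube charged, so the positivity
  condition disappears and one constant serves them all. Preimages under the chart and real values
  replace the image measure.\<close>

lemma quasi_bernoulli_uniform_measure:
  fixes \<mu> :: "(real^'n) measure"
  assumes "cube_prob \<mu>" "quasi_bernoulli \<mu>" "topological_support \<mu> = cbox 0 1"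
  shows "\<exists>C\<ge>1. \<forall>p k A. k \<in> indices p \<longrightarrow> A \<in> sets borel \<longrightarrow> A \<subseteq> cbox 0 1 \<longrightarrow>
    measure \<mu> A / C \<le> measure (uniform_measure \<mu> (dyadic_cube p k)) (dyadic_chart p k -` A) \<and>
    measure (uniform_measure \<mu> (dyadic_cube p k)) (dyadic_chart p k -` A) \<le> C * measure \<mu> A"
proof -
  note basic = cube_prob_space_sets[OF assms(1)]
  interpret prob_space \<mu> by (rule basic)
  obtain C where C: "1 \<le> C" and bern: "\<And>p k A. (\<forall>i. k i < 2 ^ p) \<Longrightarrow> 0 < emeasure \<mu> (dyadic_cube p k) \<Longrightarrow>
      A \<in> sets borel \<Longrightarrow> A \<subseteq> cbox 0 1 \<Longrightarrow>
      ennreal (1 / C) * emeasure \<mu> A \<le> emeasure (rescaled_measure \<mu> p k) A \<and>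
      emeasure (rescaled_measure \<mu> p k) A \<le> ennreal C * emeasure \<mu> A"
    using assms(2) unfolding quasi_bernoulli_def by blast
  have "measure \<mu> A / C \<le> measure (uniform_measure \<mu> (dyadic_cube p k)) (dyadic_chart p k -` A) \<and>
    measure (uniform_measure \<mu> (dyadic_cube p k)) (dyadic_chart p k -` A) \<le> C * measure \<mu> A"
    if k: "k \<in> indices p" and A: "A \<in> sets borel" "A \<subseteq> cbox 0 1" for p k A
  proof -
    define \<nu> where "\<nu> = uniform_measure \<mu> (dyadic_cube p k)"
    have pos: "0 < emeasure \<mu> (dyadic_cube p k)"
      using assms(3) basic(2) k by (rule emeasure_dyadic_cube_pos)
    then interpret \<nu>: prob_space \<nu>
      unfolding \<nu>_def by (intro prob_space_uniform_measure) auto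
    have "dyadic_chart p k \<in> measurable \<nu> borel"
      unfolding \<nu>_def using basic(2) dyadic_chart_measurable[of p k] by (simp cong: measurable_cong_sets)
    then have "emeasure (rescaled_measure \<mu> p k) A = emeasure \<nu> (dyadic_chart p k -` A)"
      unfolding rescaled_measure_def \<nu>_def[symmetric] using A(1) basic(3)
      by (subst emeasure_distr) (auto simp: \<nu>_def)
    then have "ennreal (1 / C) * emeasure \<mu> A \<le> emeasure \<nu> (dyadic_chart p k -` A)"
      "emeasure \<nu> (dyadic_chart p k -` A) \<le> ennreal C * emeasure \<mu> A"
      using bern[of k p A] k A pos by (auto simp: indices_def)
    then show ?thesis
      using C unfolding \<nu>_def[symmetric] emeasure_eq_measure \<nu>.emeasure_eq_measure
      by (simp add: ennreal_mult[symmetric])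
  qed
  with C show ?thesis
    by blast
qed

section \<open>The dimension bound\<close>

text \<open>The largest of the numbers s \<tau>_k - \<Sum>_(j \<le> k) (\<tau>_k - \<tau>_j) is
  taken as a'; that it lies below the lower dimension restates
  \<open>ereal s < dim_bound \<mu> \<tau>\<close>, and a is any real strictly between. The gap a -
  a' is the spare exponent of the mass estimate.\<close>

lemma ex_exponents:
  fixes \<mu> :: "(real^'n::{finite,wellorder}) measure" and \<tau> :: "'n \<Rightarrow> real"
  assumes s: "0 < s" "ereal s < dim_bound \<mu> \<tau>" and \<tau>: "\<And>i. 1 \<le> \<tau> i"
  shows "\<exists>a' a. s \<le> a' \<and> a' < a \<and> ereal a < lower_hausdorff_dim \<mu> \<and>
    (\<forall>k. s * \<tau> k \<le> a' + (\<Sum>j\<in>{..k}. \<tau> k - \<tau> j))"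
proof -
  define \<alpha> where "\<alpha> = lower_hausdorff_dim \<mu>"
  define S where "S k = (\<Sum>j\<in>{..k}. \<tau> k - \<tau> j)" for k
  define a' where "a' = Max (range (\<lambda>k. s * \<tau> k - S k))"
  have a': "s * \<tau> k - S k \<le> a'" for k
    unfolding a'_def by (intro Max_ge) auto
  have "ereal (s * \<tau> k - S k) < \<alpha>" for k
  proof -
    have "ereal s < (\<alpha> + ereal (S k)) / ereal (\<tau> k)"
      using s(2) unfolding dim_bound_def \<alpha>_def[symmetric] S_def[symmetric]
      by (subst (asm) Min_gr_iff) auto
    then have "ereal (\<tau> k) * ereal s < \<alpha> + ereal (S k)"
      using \<tau>[of k] by (subst (asm) ereal_less_divide_pos) auto
    then show ?thesis
      by (cases \<alpha>) (auto simp: mult.commute)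
  qed
  moreover have "a' \<in> range (\<lambda>k. s * \<tau> k - S k)"
    unfolding a'_def by (intro Max_in) auto
  ultimately have "ereal a' < \<alpha>"
    by auto
  then obtain a where a: "ereal a' < ereal a" "ereal a < \<alpha>"
    using ereal_dense2 by blast
  \<comment> \<open>For the first coordinate the sum vanishes, which gives
    \<open>s * \<tau> k0 \<le> a'\<close>, and \<open>1 \<le> \<tau> k0\<close> then gives
    \<open>s \<le> a'\<close>.\<close>
  define k0 :: 'n where "k0 = (LEAST k. True)"
  have "{..k0} = {k0}"
    unfolding k0_def by (auto intro: Least_le antisym)
  then have "S k0 = 0"
    by (simp add: S_def)
  moreover have "s * 1 \<le> s * \<tau> k0"
    using s(1) \<tau> by (intro mult_left_mono) auto
  ultimately have "s \<le> a'"
    using a'[of k0] by simp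
  then show ?thesis
    using a a' unfolding \<alpha>_def S_def by (intro exI[of _ a'] exI[of _ a]) (auto simp: algebra_simps)
qed

text \<open>One Frostman set of \<mu> is pulled back to every cube by its chart. The lower
  quasi-Bernoulli bound keeps its relative mass above a fixed \<open>\<kappa>\<close>, the upper one
  transfers the ball estimate, so the constants are the same for all cubes.\<close>

lemma rectangles_content_lower_bound:
  fixes \<mu> :: "(real^'n::{finite,wellorder}) measure"
    and x :: "nat \<Rightarrow> real^'n::_" and r :: "nat \<Rightarrow> real"
    and \<tau> :: "'n \<Rightarrow> real" and Q :: "nat \<Rightarrow> real^'n::_^'n::_"
  assumes \<mu>: "cube_prob \<mu>" "quasi_bernoulli \<mu>" "topological_support \<mu> = cbox 0 1"
    and r: "\<And>n. 0 < r n" "r \<longlonglongrightarrow> 0"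
    and full: "emeasure \<mu> (limsup (\<lambda>n. inf_cball (x n) (r n))) = 1"
    and \<tau>: "\<And>i. 1 \<le> \<tau> i" "mono \<tau>" and Q: "\<And>n. orthogonal_matrix (Q n)"
    and s: "0 < s" "s \<le> a'" "a' < a" "ereal a < lower_hausdorff_dim \<mu>"
    and bound: "\<And>k. s * \<tau> k \<le> a' + (\<Sum>j\<in>{..k}. \<tau> k - \<tau> j)"
  shows "s < CARD('n)" and "\<exists>c>0. \<forall>N p k. k \<in> indices p \<longrightarrow> (\<exists>i. c * (2 powr - s) ^ p \<le>
    cap (2 powr - s) (cubes_in (\<Union>n\<in>{N..}. interior (rectangle \<tau> (x n) (r n) (Q n))) (p + i)) i p k)"
proof -
  note basic = cube_prob_space_sets[OF \<mu>(1)]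
  interpret prob_space \<mu> by (rule basic)
  obtain E0 \<eta> b where E0: "closed E0" "0 < \<eta>" "\<And>y i. y \<in> E0 \<Longrightarrow> \<eta> \<le> y $ i \<and> y $ i \<le> 1 - \<eta>"
    and b: "0 < b" "\<And>y \<rho>. y \<in> E0 \<Longrightarrow> 0 < \<rho> \<Longrightarrow> \<rho> < b \<Longrightarrow> measure \<mu> (ball y \<rho>) \<le> \<rho> powr a"
    and E0_pos: "0 < measure \<mu> E0"
    using ex_frostman_set[OF \<mu>(1,3) s(4)] by metis
  have E0_box: "E0 \<subseteq> cbox 0 1"
  proof
    fix y assume "y \<in> E0"
    then have "0 \<le> y $ i \<and> y $ i \<le> 1" for i
      using E0(2) E0(3)[of y i] by linarith
    then show "y \<in> cbox 0 1"
      by (simp add: mem_box_cart)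
  qed
  have "a \<le> CARD('n)"
    using finite_measure_axioms basic(2) E0(1) E0_box E0_pos b by (rule frostman_exponent_le)
  with s show s_less: "s < CARD('n)"
    by linarith
  obtain C where C: "1 \<le> C" and bern: "\<And>p k A. k \<in> indices p \<Longrightarrow> A \<in> sets borel \<Longrightarrow> A \<subseteq> cbox 0 1 \<Longrightarrow>
    measure \<mu> A / C \<le> measure (uniform_measure \<mu> (dyadic_cube p k)) (dyadic_chart p k -` A) \<and>
    measure (uniform_measure \<mu> (dyadic_cube p k)) (dyadic_chart p k -` A) \<le> C * measure \<mu> A"
    using quasi_bernoulli_uniform_measure[OF \<mu>] by metis
  \<comment> \<open>\<open>C\<close> serves the rescaled radii below b; for larger ones the trivial
    mass bound 1 is enough, and \<open>b powr - a\<close> compensates for it.\<close>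
  define C1 where "C1 = C + b powr - a"
  have C1: "0 < C1"
    using C by (simp add: C1_def add_pos_nonneg)
  define L where "L = real CARD('n)"
  have L: "1 \<le> L"
    unfolding L_def using zero_less_card_finite[where 'a = 'n] by linarith
  define \<kappa> where "\<kappa> = measure \<mu> E0 / C"
  have \<kappa>: "0 < \<kappa>"
    using E0_pos C by (simp add: \<kappa>_def)
  define c where "c = \<kappa> / 2 * (1 / 2) ^ CARD('n) / (C1 * ((34 * L) powr a + (31 * L) powr a * (2 * L) ^ CARD('n)))"
  have "0 < c"
    unfolding c_def using \<kappa> C1 L by (intro divide_pos_pos mult_pos_pos add_pos_nonneg) auto
  moreover have "\<exists>i. c * (2 powr - s) ^ p \<le>
    cap (2 powr - s) (cubes_in (\<Union>n\<in>{N..}. interior (rectangle \<tau> (x n) (r n) (Q n))) (p + i)) i p k"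
    if k: "k \<in> indices p" for N p k
  proof -
    define D where "D = dyadic_cube p k"
    define \<nu> where "\<nu> = uniform_measure \<mu> D"
    define E where "E = dyadic_chart p k -` E0"
    define \<delta> :: real where "\<delta> = (1 / 2) ^ p"
    have \<delta>: "0 < \<delta>" "2 ^ p * \<delta> = 1"
      by (simp_all add: \<delta>_def power_one_over)
    have D_sets: "D \<in> sets \<mu>"
      by (simp add: D_def basic(2) dyadic_cube_sets)
    have \<nu>_sets: "sets \<nu> = sets borel"
      by (simp add: \<nu>_def basic(2))
    have "0 < emeasure \<mu> D"
      unfolding D_def using \<mu>(3) basic(2) k by (rule emeasure_dyadic_cube_pos)
    then interpret \<nu>: prob_space \<nu>
      unfolding \<nu>_def by (intro prob_space_uniform_measure) auto
    have E: "E \<in> sets borel"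
      unfolding E_def using measurable_sets[OF dyadic_chart_measurable borel_closed[OF E0(1)]] by simp
    show ?thesis
      unfolding c_def L_def
    proof (rule content_of_rectangles_in_cube[where \<nu> = \<nu> and E = E and \<eta> = "\<eta> * \<delta>"])
      show "ball e (\<eta> * \<delta>) \<subseteq> dyadic_cube p k" if e: "e \<in> E" for e
      proof
        fix y assume "y \<in> ball e (\<eta> * \<delta>)"
        then have "2 ^ p * dist e y < 2 ^ p * (\<eta> * \<delta>)"
          by simp
        then have "dist (dyadic_chart p k e) (dyadic_chart p k y) < \<eta>"
          using \<delta>(2) by (simp add: dist_dyadic_chart mult.left_commute)
        then have "\<bar>dyadic_chart p k e $ i - dyadic_chart p k y $ i\<bar> < \<eta>" for i
          using component_le_norm_cart[of "dyadic_chart p k e - dyadic_chart p k y" i]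
          by (simp add: dist_norm)
        moreover have "\<eta> \<le> dyadic_chart p k e $ i \<and> dyadic_chart p k e $ i \<le> 1 - \<eta>" for i
          using E0(3) e by (simp add: E_def)
        ultimately have "0 \<le> dyadic_chart p k y $ i \<and> dyadic_chart p k y $ i \<le> 1" for i
          by (smt (verit))
        then show "y \<in> dyadic_cube p k"
          by (simp add: dyadic_chart_mem[symmetric] mem_box_cart)
      qed
      show "measure \<nu> (ball e \<rho>) \<le> C1 * (\<rho> / (1 / 2) ^ p) powr a" if e: "e \<in> E" and \<rho>: "0 < \<rho>" for e \<rho>
        unfolding \<delta>_def[symmetric]
      proof (cases "\<rho> / \<delta> < b")
        case True
        define A where "A = cbox 0 1 \<inter> ball (dyadic_chart p k e) (\<rho> / \<delta>)"
        have "D \<inter> ball e \<rho> = D \<inter> dyadic_chart p k -` A"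
        proof -
          have "dist (dyadic_chart p k e) (dyadic_chart p k y) < \<rho> / \<delta> \<longleftrightarrow> dist e y < \<rho>" for y
          proof -
            have "dist (dyadic_chart p k e) (dyadic_chart p k y) = dist e y / \<delta>"
              by (simp add: dist_dyadic_chart \<delta>_def power_one_over)
            then show ?thesis
              using \<delta>(1) by (simp add: divide_less_cancel)
          qed
          then show ?thesis
            by (auto simp: A_def D_def dyadic_chart_mem)
        qed
        moreover have "dyadic_chart p k -` A \<in> sets \<mu>"
          using measurable_sets[OF dyadic_chart_measurable[of p k], of A] by (simp add: A_def basic(2))
        ultimately have "emeasure \<nu> (ball e \<rho>) = emeasure \<nu> (dyadic_chart p k -` A)"
          using D_sets basic(2) by (simp add: \<nu>_def)
        then have "measure \<nu> (ball e \<rho>) = measure \<nu> (dyadic_chart p k -` A)"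
          by (simp add: measure_def)
        also have "\<dots> \<le> C * measure \<mu> A"
          unfolding \<nu>_def D_def using bern[OF k, of A] by (simp add: A_def)
        also have "measure \<mu> A \<le> measure \<mu> (ball (dyadic_chart p k e) (\<rho> / \<delta>))"
          using basic(2) by (intro finite_measure_mono) (auto simp: A_def)
        also have "\<dots> \<le> (\<rho> / \<delta>) powr a"
          using True \<rho> \<delta>(1) e by (intro b(2)) (auto simp: E_def)
        also have "C * (\<rho> / \<delta>) powr a \<le> C1 * (\<rho> / \<delta>) powr a"
          by (intro mult_right_mono) (auto simp: C1_def)
        finally show "measure \<nu> (ball e \<rho>) \<le> C1 * (\<rho> / \<delta>) powr a"
          using C by (simp add: mult_left_mono)
      next
        case False
        have "measure \<nu> (ball e \<rho>) \<le> b powr - a * b powr a"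
          using b(1) by (simp add: powr_add[symmetric])
        also have "\<dots> \<le> C1 * (\<rho> / \<delta>) powr a"
          using False b(1) C C1 s by (intro mult_mono powr_mono2) (auto simp: C1_def)
        finally show "measure \<nu> (ball e \<rho>) \<le> C1 * (\<rho> / \<delta>) powr a" .
      qed
      show "measure \<nu> (E - (\<Union>n\<in>{N..}. cball (x n) (real CARD('n) * r n))) = 0" for N
      proof -
        define W where "W = (\<Union>n\<in>{N..}. cball (x n) (real CARD('n) * r n))"
        define X where "X = limsup (\<lambda>n. inf_cball (x n) (r n))"
        \<comment> \<open>A sup-norm ball of radius r lies in the Euclidean ball of radius d r,
          which is why the radii carry the factor \<open>CARD('n)\<close>.\<close>
        have "X \<subseteq> W"
        proof
          fix y assume "y \<in> X"
          then have "y \<in> (\<Union>n\<in>{N..}. inf_cball (x n) (r n))"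
            unfolding X_def limsup_INF_SUP by blast
          then show "y \<in> W"
            unfolding W_def using inf_cball_subset_cball by blast
        qed
        \<comment> \<open>Measurability follows from the mass itself: \<open>emeasure\<close> is 0
          on non-measurable sets, but here it is 1.\<close>
        have X_sets: "X \<in> sets \<mu>"
          unfolding X_def using full emeasure_notin_sets by fastforce
        have "W \<in> sets \<mu>"
          unfolding W_def using basic(2) by auto
        have "measure \<mu> (UNIV - X) = 0"
          using prob_compl[OF X_sets] full basic(3) by (simp add: X_def measure_def)
        moreover have "measure \<mu> (D \<inter> (E - W)) \<le> measure \<mu> (UNIV - X)"
          using \<open>X \<subseteq> W\<close> X_sets sets.compl_sets[OF X_sets] basic(3) by (intro finite_measure_mono) auto
        ultimately have "measure \<mu> (D \<inter> (E - W)) = 0"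
          by (simp add: measure_le_0_iff)
        then have "emeasure \<nu> (E - W) = 0"
          using D_sets E \<open>W \<in> sets \<mu>\<close> basic(2) by (simp add: \<nu>_def emeasure_eq_measure)
        then show ?thesis
          by (simp add: W_def measure_def)
      qed
      show "\<kappa> \<le> measure \<nu> E"
        unfolding \<kappa>_def \<nu>_def D_def E_def using bern[OF k _ E0_box] E0(1) by auto
    qed (use r \<tau> Q s bound s_less \<nu>.finite_measure_axioms \<nu>_sets C1 E E0(2) \<delta>(1) \<kappa> in auto)
  qed
  ultimately show "\<exists>c>0. \<forall>N p k. k \<in> indices p \<longrightarrow> (\<exists>i. c * (2 powr - s) ^ p \<le>
    cap (2 powr - s) (cubes_in (\<Union>n\<in>{N..}. interior (rectangle \<tau> (x n) (r n) (Q n))) (p + i)) i p k)"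
    by blast
qed

theorem theorem2p4:
  fixes \<mu> :: "(real^'n::{finite,wellorder}) measure"
    and x :: "nat \<Rightarrow> real^'n::_" and r :: "nat \<Rightarrow> real"
    and \<tau> :: "'n \<Rightarrow> real" and Q :: "nat \<Rightarrow> real^'n::_^'n::_"
  assumes "cube_prob \<mu>"
    and "quasi_bernoulli \<mu>"
    and "topological_support \<mu> = cbox 0 1"
    and "\<And>n. 0 < r n"
    and "\<And>n. inf_cball (x n) (r n) \<subseteq> cbox 0 1"
    and "r \<longlonglongrightarrow> 0"
    and "emeasure \<mu> (limsup (\<lambda>n. inf_cball (x n) (r n))) = 1"
    and "\<And>i. 1 \<le> \<tau> i"
    and "mono \<tau>"
    and "\<And>n. orthogonal_matrix (Q n)"
  shows "dim_bound \<mu> \<tau> \<le> hausdorff_dim (limsup (\<lambda>n. rectangle \<tau> (x n) (r n) (Q n)))"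
proof (unfold hausdorff_dim_def, rule Inf_greatest, clarsimp)
  fix s :: real assume "0 < s"
    and zero: "hausdorff_measure s (limsup (\<lambda>n. rectangle \<tau> (x n) (r n) (Q n))) = 0"
  show "dim_bound \<mu> \<tau> \<le> ereal s"
  proof (rule ccontr)
    assume "\<not> ?thesis"
    then have less: "ereal s < dim_bound \<mu> \<tau>"
      by simp
    obtain a' a where s: "0 < s" "s \<le> a'" "a' < a" "ereal a < lower_hausdorff_dim \<mu>"
      and bound: "\<And>k. s * \<tau> k \<le> a' + (\<Sum>j\<in>{..k}. \<tau> k - \<tau> j)"
      using ex_exponents[OF \<open>0 < s\<close> less assms(8)] \<open>0 < s\<close> by blast
    define G where "G N = (\<Union>n\<in>{N..}. interior (rectangle \<tau> (x n) (r n) (Q n)))" for N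
    define q where "q = (2::real) powr - s"
    note content = rectangles_content_lower_bound[where x = x and r = r and Q = Q, OF assms(1-4,6-10) s bound]
    obtain c where c: "0 < c" "\<And>N p k. k \<in> indices p \<Longrightarrow> \<exists>i. c * q ^ p \<le> cap q (cubes_in (G N) (p + i)) i p k"
      using content(2) unfolding G_def q_def by blast
    have q: "0 < q" "1 < 2 ^ CARD('n) * q"
    proof -
      have "2 ^ CARD('n) * q = 2 powr (CARD('n) - s)"
        by (simp add: q_def powr_diff powr_minus powr_realpow field_simps)
      then show "0 < q" "1 < 2 ^ CARD('n) * q"
        using content(1) by (auto simp: q_def)
    qed
    \<comment> \<open>The proportion c improves to the full content; this is where s < d is
      used.\<close>
    have "\<exists>i. q ^ p \<le> cap q (cubes_in (G N) (p + i)) i p k" if "k \<in> indices p" for N p and k :: "'n \<Rightarrow> nat"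
      by (rule cap_full[OF cubes_in_children q c that])
    then have "hausdorff_measure s (\<Inter>N. G N) \<noteq> 0"
      using s(1) content(1) unfolding q_def by (intro hausdorff_measure_Inter_open) auto
    \<comment> \<open>Passing to interiors only shrinks the limsup set, so nonzero measure of the
      smaller set contradicts \<open>zero\<close>.\<close>
    moreover have "(\<Inter>N. G N) \<subseteq> limsup (\<lambda>n. rectangle \<tau> (x n) (r n) (Q n))"
      unfolding limsup_INF_SUP G_def by (intro INF_mono' SUP_mono' interior_subset)
    then have "hausdorff_measure s (\<Inter>N. G N) \<le> 0"
      unfolding zero[symmetric] by (rule hausdorff_measure_mono)
    ultimately show False
      by simp
  qed
qed

end
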